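(* The potential measure $G(x,\mathrm{d}y)$ of the CB process $(Z_t)_{t\ge 0}$ with branching mechanism $\psi$ has a density with respect to the Lebesgue measure given by $$g(x,y)=\frac{W(y)-W(y-x)}{y},\qquad x,y>0.$$ Moreover, $G(x,\mathrm{d}y)$ converges vaguely to the stationary measure $\mu(\mathrm{d}y)=\frac{W(y)}{y}\,\mathrm{d}y$ as $x\to+\infty$.
   Context: Branching mechanism: $\psi(\lambda)=\alpha\lambda+\frac12\sigma^2\lambda^2+\int_0^{+\infty}(e^{-\lambda r}-1+\lambda r)\,\pi(\mathrm{d}r)$, $\lambda\ge 0$, where $\alpha\ge 0$, $\sigma\ge 0$ and $\pi$ is a positive Radon measure on $(0,+\infty)$ with $\int_0^{+\infty}(r\wedge r^2)\,\pi(\mathrm{d}r)<+\infty$. It is assumed that $\psi(+\infty)=+\infty$ and $\int^{+\infty}\frac{1}{\psi(\lambda)}\,\mathrm{d}\lambda<+\infty$ (integrability at $+\infty$). CB process: $((Z_t)_{t\ge 0},(\mathbb{P}_x)_{x\ge 0})$ is the $[0,+\infty)$-valued right continuous strong Markov process with left limits, absorbed at $0$, with $\mathbb{P}_x(Z_0=x)=1$, and such that the $\mathbb{P}_x$-expectation of $e^{-\lambda Z_t}$ equals $e^{-x u_t(\lambda)}$ for $\lambda>0$, $t\ge 0$, where $\frac{\partial}{\partial t}u_t(\lambda)=-\psi(u_t(\lambda))$, $u_0(\lambda)=\lambda$. Potential measure: for $x>0$ and Borel $A\subset(0,+\infty)$, $G(x,A):=\int_0^{+\infty}\mathbb{P}_x(Z_t\in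 A)\,\mathrm{d}t\in[0,+\infty]$; $G(x,\cdot)$ is a measure on $(0,+\infty)$. Scale function: $W$ is the unique strictly increasing, nonnegative, continuous function on $[0,+\infty)$ with $\int_0^{+\infty}e^{-\lambda x}W(x)\,\mathrm{d}x=\frac1{\psi(\lambda)}$ for all $\lambda>0$; $W(x):=0$ for $x<0$. Stationary measure: a Radon measure $\nu$ on $(0,+\infty)$ such that $\int_{(0,+\infty)}\mathbb{P}_x(Z_t\in A)\,\nu(\mathrm{d}x)=\nu(A)$ for every $t>0$ and every Borel set $A\subset(0,+\infty)$; $\mu$ is the unique one up to a constant multiple. Vague convergence: measures on $(0,+\infty)$ are extended to $[0,+\infty)$ by giving mass $0$ to $\{0\}$, and a family $\nu_x$ is said to converge vaguely to $\nu$ as $x\to+\infty$ if $\int_{[0,+\infty)}g(y)\,\nu_x(\mathrm{d}y)\to\int_{[0,+\infty)}g(y)\,\nu(\mathrm{d}y)$ for all continuous functions $g$ on $[0,+\infty)$ vanishing at infinity.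
   Formalization: Vague convergence is stated for those continuous g vanishing at infinity whose integral against μ is defined in the extended reals; μ may have infinite mass, so for other g (e.g. sin(y)/(1+y) when ψ(λ)=λ²) the limiting integral is of the form ∞−∞. *)

theory Defs
  imports "HOL-Probability.Probability"
begin

section \<open>Radon measures and vague convergence on intervals\<close>

text \<open>
  For the open or closed half-line S, a Borel measure on S is Radon iff it is finite on compact
  subsets of S. Measures on \<open>(0, \<infinity>)\<close> have the set \<open>{0<..}\<close> itself as their space.
\<close>

definition radon_on :: "real set \<Rightarrow> real measure \<Rightarrow> bool" where
  "radon_on S \<nu> \<longleftrightarrow>
     sets \<nu> = sets (restrict_space borel S) \<and>
     (\<forall>K. compact K \<and> K \<subseteq> S \<longrightarrow> emeasure \<nu> K < \<infinity>)"

text \<open>Extension of a measure on \<open>(0, \<infinity>)\<close> to \<open>[0, \<infinity>)\<close>, with mass 0 at 0.\<close>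

definition extend_by_zero :: "real measure \<Rightarrow> real measure" where
  "extend_by_zero \<nu> = distr \<nu> (restrict_space borel {0..}) (\<lambda>y. y)"

text \<open>
  A continuous function vanishing at infinity need not be integrable with respect to a Radon
  measure of infinite mass. Integrals are therefore taken in the extended reals and are meaningful
  as soon as the positive or the negative part of the integrand has a finite integral; in particular
  this covers all nonnegative integrands.
\<close>

definition integral_exists :: "'a measure \<Rightarrow> ('a \<Rightarrow> real) \<Rightarrow> bool" where
  "integral_exists \<nu> g \<longleftrightarrow>
     g \<in> borel_measurable \<nu> \<and>
     ((\<integral>\<^sup>+y. ennreal (g y) \<partial>\<nu>) < \<infinity> \<or> (\<integral>\<^sup>+y. ennreal (- g y) \<partial>\<nu>) < \<infinity>)"

definition extended_integral :: "'a measure \<Rightarrow> ('a \<Rightarrow> real) \<Rightarrow> ereal" where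
  "extended_integral \<nu> g =
     enn2ereal (\<integral>\<^sup>+y. ennreal (g y) \<partial>\<nu>) - enn2ereal (\<integral>\<^sup>+y. ennreal (- g y) \<partial>\<nu>)"

text \<open>
  The test functions are all continuous functions on \<open>[0, \<infinity>)\<close> vanishing at infinity for which the
  limiting integral is meaningful. By the Radon conditions on \<open>[0, \<infinity>)\<close>, these include all compactly
  supported continuous functions, for which the integrals are finite.
\<close>

definition vaguely_converges :: "('i \<Rightarrow> real measure) \<Rightarrow> real measure \<Rightarrow> 'i filter \<Rightarrow> bool" where
  "vaguely_converges \<nu> \<nu>' F \<longleftrightarrow>
     (\<forall>\<^sub>F i in F. radon_on {0..} (extend_by_zero (\<nu> i))) \<and>
     radon_on {0..} (extend_by_zero \<nu>') \<and>
     (\<forall>g. continuous_on {0..} g \<and> (g \<longlongrightarrow> 0) at_top \<and> integral_exists (extend_by_zero \<nu>') g \<longrightarrow>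
        (\<forall>\<^sub>F i in F. integral_exists (extend_by_zero (\<nu> i)) g) \<and>
        ((\<lambda>i. extended_integral (extend_by_zero (\<nu> i)) g)
           \<longlongrightarrow> extended_integral (extend_by_zero \<nu>') g) F)"


section \<open>Branching mechanisms and scale functions\<close>

definition branching_mechanism :: "real \<Rightarrow> real \<Rightarrow> real measure \<Rightarrow> real \<Rightarrow> real" where
  "branching_mechanism \<alpha> \<sigma> \<pi> l =
     \<alpha> * l + 1/2 * \<sigma>\<^sup>2 * l\<^sup>2 + (\<integral>r. (exp (- l * r) - 1 + l * r) \<partial>\<pi>)"

text \<open>Uniqueness of W for a given mechanism is not part of the definition.\<close>

definition scale_function :: "(real \<Rightarrow> real) \<Rightarrow> (real \<Rightarrow> real) \<Rightarrow> bool" where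
  "scale_function \<psi> W \<longleftrightarrow>
     strict_mono_on {0..} W \<and> (\<forall>x\<ge>0. 0 \<le> W x) \<and> continuous_on {0..} W \<and>
     (\<forall>x<0. W x = 0) \<and>
     (\<forall>l>0. set_integrable lborel {0..} (\<lambda>x. exp (- l * x) * W x) \<and>
             (LINT x:{0..}|lborel. exp (- l * x) * W x) = 1 / \<psi> l)"


section \<open>Continuous-state branching processes\<close>

text \<open>
  Natural filtration of Z, indexed by \<open>[0, \<infinity>]\<close> so that stopping times may take the value \<open>\<infinity>\<close>.
  The strong Markov property with respect to any larger filtration implies the one with respect
  to this filtration.
\<close>

definition natural_filtration :: "'w set \<Rightarrow> (real \<Rightarrow> 'w \<Rightarrow> real) \<Rightarrow> ennreal \<Rightarrow> 'w measure" where
  "natural_filtration \<Omega> Z t =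
     sigma \<Omega> {Z s -` B \<inter> \<Omega> | s B. 0 \<le> s \<and> ennreal s \<le> t \<and> B \<in> sets borel}"

lemma filtration_natural_filtration: "filtration \<Omega> (natural_filtration \<Omega> Z)"
proof
  show "space (natural_filtration \<Omega> Z t) = \<Omega>" for t
    unfolding natural_filtration_def by (intro space_measure_of) auto
  show "sets (natural_filtration \<Omega> Z s) \<le> sets (natural_filtration \<Omega> Z t)" if "s \<le> t" for s t
  proof -
    have "{Z r -` B \<inter> \<Omega> | r B. 0 \<le> r \<and> ennreal r \<le> s \<and> B \<in> sets borel}
       \<subseteq> {Z r -` B \<inter> \<Omega> | r B. 0 \<le> r \<and> ennreal r \<le> t \<and> B \<in> sets borel}"
      using that order_trans by blast
    moreover have "{Z r -` B \<inter> \<Omega> | r B. 0 \<le> r \<and> ennreal r \<le> u \<and> B \<in> sets borel} \<subseteq> Pow \<Omega>" for u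
      by auto
    ultimately show ?thesis
      unfolding natural_filtration_def by (simp add: sigma_sets_mono')
  qed
qed

text \<open>The function \<open>u t l\<close> is the cumulant semigroup, \<open>u\<^sub>t(\<lambda>)\<close> in the usual notation.\<close>

definition cumulant_flow :: "(real \<Rightarrow> real) \<Rightarrow> (real \<Rightarrow> real \<Rightarrow> real) \<Rightarrow> bool" where
  "cumulant_flow \<psi> u \<longleftrightarrow>
     (\<forall>l>0. u 0 l = l \<and>
        (\<forall>t\<ge>0. 0 \<le> u t l \<and> ((\<lambda>s. u s l) has_real_derivative - \<psi> (u t l)) (at t within {0..})))"

locale cb_process =
  fixes \<psi> :: "real \<Rightarrow> real"
    and M :: "'w measure" \<comment> \<open>only its space and sigma-algebra matter\<close>
    and P :: "real \<Rightarrow> 'w measure"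
    and Z :: "real \<Rightarrow> 'w \<Rightarrow> real"
  assumes prob_space_P: "\<And>x. 0 \<le> x \<Longrightarrow> prob_space (P x)"
    and sets_P: "\<And>x. 0 \<le> x \<Longrightarrow> sets (P x) = sets M"
    and measurable_Z: "\<And>t. 0 \<le> t \<Longrightarrow> Z t \<in> borel_measurable M"
    and nonneg: "\<And>t \<omega>. 0 \<le> t \<Longrightarrow> \<omega> \<in> space M \<Longrightarrow> 0 \<le> Z t \<omega>"
    and right_continuous: "\<And>t \<omega>. 0 \<le> t \<Longrightarrow> \<omega> \<in> space M \<Longrightarrow> continuous (at_right t) (\<lambda>s. Z s \<omega>)"
    and left_limits: "\<And>t \<omega>. 0 < t \<Longrightarrow> \<omega> \<in> space M \<Longrightarrow> \<exists>l. ((\<lambda>s. Z s \<omega>) \<longlongrightarrow> l) (at_left t)"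
    and absorbed: "\<And>x. 0 \<le> x \<Longrightarrow>
          AE \<omega> in P x. \<forall>s t. 0 \<le> s \<longrightarrow> s \<le> t \<longrightarrow> Z s \<omega> = 0 \<longrightarrow> Z t \<omega> = 0"
    and start: "\<And>x. 0 \<le> x \<Longrightarrow> emeasure (P x) {\<omega> \<in> space M. Z 0 \<omega> = x} = 1"
    and measurable_kernel: "\<And>t B. 0 \<le> t \<Longrightarrow> B \<in> sets borel \<Longrightarrow>
          (\<lambda>x. emeasure (P x) {\<omega> \<in> space M. Z t \<omega> \<in> B})
            \<in> borel_measurable (restrict_space borel {0..})"
    and strong_markov: "\<And>x \<tau> A t B.
          0 \<le> x \<Longrightarrow> stopping_time (natural_filtration (space M) Z) \<tau> \<Longrightarrow>
          A \<in> sets (filtration.pre_sigma (space M) (natural_filtration (space M) Z) \<tau>) \<Longrightarrow>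
          0 \<le> t \<Longrightarrow> B \<in> sets borel \<Longrightarrow>
          emeasure (P x) {\<omega> \<in> A. \<tau> \<omega> < \<infinity> \<and> Z (enn2real (\<tau> \<omega>) + t) \<omega> \<in> B} =
          (\<integral>\<^sup>+\<omega>\<in>{\<omega> \<in> A. \<tau> \<omega> < \<infinity>}.
             emeasure (P (Z (enn2real (\<tau> \<omega>)) \<omega>)) {\<omega>' \<in> space M. Z t \<omega>' \<in> B} \<partial>P x)"
    and laplace: "\<exists>u. cumulant_flow \<psi> u \<and>
          (\<forall>x l t. 0 \<le> x \<longrightarrow> 0 < l \<longrightarrow> 0 \<le> t \<longrightarrow>
             (\<integral>\<omega>. exp (- l * Z t \<omega>) \<partial>P x) = exp (- x * u t l))"


section \<open>Potential measure and stationary measure\<close>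

text \<open>
  If the set function below failed to be countably additive, \<^const>\<open>measure_of\<close> would return the
  zero measure; this does not happen for a right-continuous process.
\<close>

definition potential_measure :: "(real \<Rightarrow> 'w measure) \<Rightarrow> (real \<Rightarrow> 'w \<Rightarrow> real) \<Rightarrow> real \<Rightarrow> real measure" where
  "potential_measure P Z x =
     measure_of {0<..} (sets (restrict_space borel {0<..}))
       (\<lambda>A. \<integral>\<^sup>+t\<in>{0..}. emeasure (P x) {\<omega> \<in> space (P x). Z t \<omega> \<in> A} \<partial>lborel)"

definition stationary_measure ::
    "(real \<Rightarrow> 'w measure) \<Rightarrow> (real \<Rightarrow> 'w \<Rightarrow> real) \<Rightarrow> real measure \<Rightarrow> bool" where
  "stationary_measure P Z \<nu> \<longleftrightarrow>
     radon_on {0<..} \<nu> \<and>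
     (\<forall>t>0. \<forall>A\<in>sets (restrict_space borel {0<..}).
        (\<integral>\<^sup>+x. emeasure (P x) {\<omega> \<in> space (P x). Z t \<omega> \<in> A} \<partial>\<nu>) = emeasure \<nu> A)"

text \<open>
  The zero measure satisfies \<^const>\<open>stationary_measure\<close>; ``the'' stationary measure is a nonzero one
  of which all others are constant multiples.
\<close>

definition the_stationary_measure ::
    "(real \<Rightarrow> 'w measure) \<Rightarrow> (real \<Rightarrow> 'w \<Rightarrow> real) \<Rightarrow> real measure \<Rightarrow> bool" where
  "the_stationary_measure P Z \<mu> \<longleftrightarrow>
     stationary_measure P Z \<mu> \<and> emeasure \<mu> (space \<mu>) \<noteq> 0 \<and>
     (\<forall>\<nu>. stationary_measure P Z \<nu> \<longrightarrow> (\<exists>c::real. 0 \<le> c \<and> \<nu> = scale_measure (ennreal c) \<mu>))"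

end

theory Submission
  imports Defs
begin

text \<open>
  Everything is read off from Laplace transforms of one-dimensional laws. The law of \<open>Z t\<close> under
  \<open>P x\<close> has transform \<open>exp (- x * u t l)\<close>, and \<open>1 / \<psi>\<close> is the transform of \<open>W\<close>. Let \<open>clock\<close> be an
  antiderivative of \<open>1 / \<psi>\<close> on the positive half-line. As \<open>u\<close> solves \<open>u' = - \<psi> u\<close>, the flow runs
  down this clock at unit speed: \<open>clock (u t l) = clock l - t\<close> (\<open>clock_flow\<close>). Integrability of
  \<open>1 / \<psi>\<close> at infinity says that the clock is bounded above.

  Measures on \<open>(0, \<infinity>)\<close> are compared through the integrals of \<open>exp (- a * y) - exp (- b * y)\<close> for
  \<open>0 < a \<le> b\<close>. These integrands vanish at 0, so the part of the process that has been absorbed never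
  enters and infinite mass near 0 does less harm. They determine the measure, because under
  \<open>y \<mapsto> exp (- y)\<close> they become the moments of a finite measure on the unit interval
  (\<open>measure_eqI_laplace_difference\<close>).

  For the potential measure started at \<open>x\<close>, the substitution \<open>l = u t a\<close> in the time integral gives
  the value \<open>\<integral> (1 - exp (- x * l)) / \<psi> l\<close> over \<open>l\<close> from \<open>a\<close> to \<open>b\<close>. Tonelli's theorem gives the same
  value for the density \<open>(W y - W (y - x)) / y\<close>: integrating \<open>exp (- l * y)\<close> over \<open>l\<close> produces the
  factor \<open>1 / y\<close>, and shifting \<open>W\<close> by \<open>x\<close> multiplies its transform by \<open>exp (- x * l)\<close>
  (\<open>potential_density\<close>).

  For the measure \<open>\<mu>\<close> with density \<open>W y / y\<close> the same computation gives \<open>clock b - clock a\<close>. One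
  step of the semigroup replaces the exponents \<open>a, b\<close> by \<open>u t a, u t b\<close>, which have the same clock
  distance; hence \<open>\<mu>\<close> is stationary (\<open>mu_stationary\<close>). Conversely, for a stationary \<open>\<nu>\<close> the integral
  of \<open>exp (- a * y) - exp (- b * y)\<close> is invariant under the flow and additive in adjacent intervals,
  hence a nonnegative additive function of the clock distance, hence a multiple of it, and \<open>\<nu>\<close> is the
  same multiple of \<open>\<mu>\<close> (\<open>stationary_unique\<close>). The delicate point is that these integrals are finite,
  as \<open>\<nu>\<close> is only known to be finite on compact sets. Stationarity gives finite integrals of
  \<open>x \<mapsto> P x (Z t \<in> K)\<close> for compact \<open>K\<close>, and for a suitable interval \<open>K\<close> this probability is
  bounded below by a multiple of \<open>min 1 (x * v t) * exp (- x * v t)\<close>, where \<open>v t\<close> is the limit of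
  \<open>u t l\<close> for \<open>l \<rightarrow> \<infinity>\<close> (\<open>law_window\<close>); since \<open>v t\<close> tends to 0 for large \<open>t\<close>, all exponents are covered.

  Finally, \<open>W\<close> vanishes on the negative half-line and increases, so the potential densities increase
  with \<open>x\<close> to \<open>W y / y\<close>, and integrals of the positive and the negative part of a test function
  converge separately.
\<close>

section \<open>Uniqueness of Laplace transforms\<close>

text \<open>
  Weierstrass approximation: equal moments give equal integrals of polynomials, and these are
  uniformly dense in the continuous functions on the unit interval.
\<close>

lemma moments_eq_imp_integral_continuous_eq:
  fixes N1 N2 :: "real measure" and f :: "real \<Rightarrow> real"
  assumes fin: "finite_measure N1" "finite_measure N2"
    and sets: "sets N1 = sets borel" "sets N2 = sets borel"
    and supp: "AE y in N1. y \<in> {0..1}" "AE y in N2. y \<in> {0..1}"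
    and moments: "\<And>n::nat. (\<integral>y. y ^ n \<partial>N1) = (\<integral>y. y ^ n \<partial>N2)"
    and f: "continuous_on UNIV f"
  shows "(\<integral>y. f y \<partial>N1) = (\<integral>y. f y \<partial>N2)"
proof (rule ccontr)
  assume ne: "(\<integral>y. f y \<partial>N1) \<noteq> (\<integral>y. f y \<partial>N2)"
  define d where "d = \<bar>(\<integral>y. f y \<partial>N1) - (\<integral>y. f y \<partial>N2)\<bar>"
  define m where "m = measure N1 UNIV + measure N2 UNIV + 1"
  have d: "d > 0" using ne by (simp add: d_def)
  have m: "m > 0" by (simp add: m_def add_nonneg_pos)
  obtain p where p: "real_polynomial_function p" "\<And>x. x \<in> {0..1} \<Longrightarrow> \<bar>f x - p x\<bar> < d / (2 * m)"
    using Stone_Weierstrass_real_polynomial_function[of "{0..1::real}" f "d / (2*m)"] d m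
      continuous_on_subset[OF f] by auto
  obtain a n where pa: "p = (\<lambda>x. \<Sum>i\<le>(n::nat). a i * x ^ i)"
    using p(1) by (auto simp: real_polynomial_function_iff_sum)
  have fmeas: "f \<in> borel_measurable borel" by (rule borel_measurable_continuous_onI[OF f])
  obtain B where B: "\<And>x. x \<in> {0..1} \<Longrightarrow> \<bar>f x\<bar> \<le> B"
    using compact_imp_bounded[OF compact_continuous_image[OF continuous_on_subset[OF f], of "{0..1}"]]
    unfolding bounded_iff real_norm_def by blast
  have approx: "integrable N f \<and> (\<integral>y. p y \<partial>N) = (\<Sum>i\<le>n. a i * (\<integral>y. y ^ i \<partial>N))
      \<and> \<bar>(\<integral>y. f y \<partial>N) - (\<integral>y. p y \<partial>N)\<bar> \<le> d / (2*m) * measure N UNIV"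
    if N: "finite_measure N" "sets N = sets borel" "AE y in N. y \<in> {0..1}" for N :: "real measure"
  proof -
    interpret finite_measure N by fact
    note [measurable_cong] = N(2)
    note [measurable] = fmeas
    have sp: "space N = UNIV" using sets_eq_imp_space_eq[OF N(2)] by simp
    have intf: "integrable N f"
      by (rule integrable_const_bound[of _ B]) (use N(3) B in \<open>auto\<close>)
    have intp: "integrable N (\<lambda>y. y ^ i)" for i
      by (rule integrable_const_bound[of _ 1]) (use N(3) in \<open>auto simp: power_le_one\<close>)
    have eq: "(\<integral>y. p y \<partial>N) = (\<Sum>i\<le>n. a i * (\<integral>y. y ^ i \<partial>N))"
      unfolding pa using intp by (subst Bochner_Integration.integral_sum) auto
    have ip: "integrable N p" unfolding pa using intp by auto
    have "\<bar>(\<integral>y. f y \<partial>N) - (\<integral>y. p y \<partial>N)\<bar> = \<bar>\<integral>y. f y - p y \<partial>N\<bar>"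
      using intf ip by simp
    also have "\<dots> \<le> (\<integral>y. \<bar>f y - p y\<bar> \<partial>N)" by (rule integral_abs_bound)
    also have "\<dots> \<le> (\<integral>y. d / (2*m) \<partial>N)"
      by (rule integral_mono_AE) (use intf ip N(3) p(2) in \<open>auto intro: less_imp_le\<close>)
    also have "\<dots> = d / (2*m) * measure N UNIV" by (simp add: sp)
    finally show ?thesis using intf eq by simp
  qed
  note A1 = approx[OF fin(1) sets(1) supp(1)] and A2 = approx[OF fin(2) sets(2) supp(2)]
  have "(\<integral>y. p y \<partial>N1) = (\<integral>y. p y \<partial>N2)" using A1 A2 moments by simp
  then have "d \<le> \<bar>(\<integral>y. f y \<partial>N1) - (\<integral>y. p y \<partial>N1)\<bar> + \<bar>(\<integral>y. f y \<partial>N2) - (\<integral>y. p y \<partial>N2)\<bar>"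
    unfolding d_def by linarith
  then have "d \<le> d / (2*m) * measure N1 UNIV + d / (2*m) * measure N2 UNIV"
    using A1 A2 by linarith
  also have "\<dots> = d / (2*m) * (m - 1)"
    by (subst distrib_left[symmetric]) (simp add: m_def)
  also have "\<dots> < d / (2*m) * (2*m)" using d m by (intro mult_strict_left_mono) auto
  also have "\<dots> = d" using m by simp
  finally show False by simp
qed

text \<open>
  Indicators of half-lines are bounded pointwise limits of continuous ramps, so the distribution
  functions agree.
\<close>

lemma finite_measure_eqI_moments:
  fixes N1 N2 :: "real measure"
  assumes fin: "finite_measure N1" "finite_measure N2"
    and sets: "sets N1 = sets borel" "sets N2 = sets borel"
    and supp: "AE y in N1. y \<in> {0..1}" "AE y in N2. y \<in> {0..1}"
    and moments: "\<And>n::nat. (\<integral>y. y ^ n \<partial>N1) = (\<integral>y. y ^ n \<partial>N2)"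
  shows "N1 = N2"
proof (rule cdf_unique')
  show "finite_borel_measure N1" "finite_borel_measure N2"
    using fin sets by (auto simp: finite_borel_measure_def finite_borel_measure_axioms_def)
  show "cdf N1 = cdf N2"
  proof
    fix x
    define f where "f k y = max 0 (min 1 (1 - real k * (y - x)))" for k y
    have fc: "continuous_on UNIV (f k)" for k
      unfolding f_def by (intro continuous_intros)
    have lim: "(\<lambda>k. f k y) \<longlonglongrightarrow> indicator {..x} y" for y
    proof (cases "y \<le> x")
      case True
      then have "f k y = 1" for k by (auto simp: f_def max_def min_def mult_nonneg_nonpos not_le)
      then show ?thesis using True by simp
    next
      case False
      then obtain K where K: "1 < real K * (y - x)"
        using reals_Archimedean3[of "y - x"] by (metis diff_gt_0_iff_gt not_le mult.commute)
      have "\<forall>\<^sub>F k in sequentially. f k y = 0"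
      proof (rule eventually_sequentiallyI[of K])
        fix k assume "K \<le> k"
        then have "real K * (y - x) \<le> real k * (y - x)" using False by (intro mult_right_mono) auto
        then show "f k y = 0" using K by (simp add: f_def)
      qed
      then show ?thesis using False by (simp add: tendsto_eventually)
    qed
    have cdf: "(\<lambda>k. \<integral>y. f k y \<partial>N) \<longlonglongrightarrow> cdf N x"
      if N: "finite_measure N" "sets N = sets borel" for N :: "real measure"
    proof -
      interpret finite_measure N by fact
      note [measurable_cong] = N(2)
      have [measurable]: "f k \<in> borel_measurable borel" for k
        by (rule borel_measurable_continuous_onI[OF fc])
      have "(\<lambda>k. \<integral>y. f k y \<partial>N) \<longlonglongrightarrow> (\<integral>y. indicator {..x} y \<partial>N)"
        by (rule integral_dominated_convergence[where w="\<lambda>_. 1"]) (auto simp: lim, auto simp: f_def)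
      then show ?thesis by (simp add: cdf_def sets_eq_imp_space_eq[OF N(2)])
    qed
    have "(\<integral>y. f k y \<partial>N1) = (\<integral>y. f k y \<partial>N2)" for k
      by (rule moments_eq_imp_integral_continuous_eq[OF assms fc])
    then show "cdf N1 x = cdf N2 x"
      using LIMSEQ_unique[OF cdf[OF fin(1) sets(1)]] cdf[OF fin(2) sets(2)] by simp
  qed
qed

text \<open>
  Under \<open>z = exp (- y)\<close> the transform at integer arguments becomes the moment sequence of a measure on
  the unit interval. The weight makes this measure finite even if the given ones are not; being
  positive, it can be divided out again.
\<close>

lemma measure_eqI_weighted_laplace:
  fixes N1 N2 :: "real measure" and w :: "real \<Rightarrow> real"
  assumes S: "S \<in> sets borel"
    and sets: "sets N1 = sets (restrict_space borel S)" "sets N2 = sets (restrict_space borel S)"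
    and supp: "AE y in N1. 0 \<le> y" "AE y in N2. 0 \<le> y"
    and w: "w \<in> borel_measurable borel" "\<And>y. y \<in> S \<Longrightarrow> 0 < w y"
    and eq: "\<And>n::nat. (\<integral>\<^sup>+y. ennreal (w y * exp (- real n * y)) \<partial>N1)
                    = (\<integral>\<^sup>+y. ennreal (w y * exp (- real n * y)) \<partial>N2)"
    and fin: "(\<integral>\<^sup>+y. ennreal (w y) \<partial>N1) < \<infinity>"
  shows "N1 = N2"
proof -
  note [measurable] = w(1)
  \<comment> \<open>the weighted image under \<open>y \<mapsto> exp (- y)\<close>, a finite measure on the unit interval\<close>
  define D where "D N = distr (density N (\<lambda>y. ennreal (w y))) borel (\<lambda>y. exp (- y))" for N :: "real measure"
  have sp: "space N = S" if "sets N = sets (restrict_space borel S)" for N :: "real measure"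
    using sets_eq_imp_space_eq[OF that] S by (simp add: space_restrict_space)
  have mb: "f \<in> borel_measurable N"
    if "f \<in> borel_measurable borel" "sets N = sets (restrict_space borel S)"
    for N :: "real measure" and f :: "real \<Rightarrow> 'b::topological_space"
    using measurable_restrict_space1[OF that(1), of S] that(2) by (simp cong: measurable_cong_sets)
  have D: "finite_measure (D N) \<and> sets (D N) = sets borel \<and> (AE y in D N. y \<in> {0..1}) \<and>
      (\<forall>n. (\<integral>y. y ^ n \<partial>D N) = enn2real (\<integral>\<^sup>+y. ennreal (w y * exp (- real n * y)) \<partial>N))"
    if N: "sets N = sets (restrict_space borel S)" "(\<integral>\<^sup>+y. ennreal (w y) \<partial>N) < \<infinity>" "AE y in N. 0 \<le> y" for N
  proof -
    have wN[measurable]: "w \<in> borel_measurable N" "(\<lambda>y. exp (- y)) \<in> borel_measurable N"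
      by (rule mb[OF _ N(1)], measurable)+
    have em: "emeasure (D N) (space (D N)) < \<infinity>"
      unfolding D_def using N(2)
      by (simp add: emeasure_distr emeasure_density space_density cong: nn_integral_cong)
    have ae: "AE y in D N. y \<in> {0..1}"
      unfolding D_def using N(3)
      by (subst AE_distr_iff) (auto simp: AE_density elim!: eventually_mono)
    have "(\<integral>y. y ^ n \<partial>D N) = enn2real (\<integral>\<^sup>+y. ennreal (w y * exp (- real n * y)) \<partial>N)" for n
    proof -
      have "(\<integral>y. y ^ n \<partial>D N) = enn2real (\<integral>\<^sup>+y. ennreal (y ^ n) \<partial>D N)"
        by (rule integral_eq_nn_integral) (use ae in \<open>auto simp: D_def\<close>)
      also have "(\<integral>\<^sup>+y. ennreal (y ^ n) \<partial>D N) = (\<integral>\<^sup>+y. ennreal (w y) * ennreal (exp (- y) ^ n) \<partial>N)"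
        unfolding D_def by (subst nn_integral_distr) (auto simp: nn_integral_density)
      also have "\<dots> = (\<integral>\<^sup>+y. ennreal (w y * exp (- real n * y)) \<partial>N)"
        using w(2) sp[OF N(1)]
        by (intro nn_integral_cong, subst ennreal_mult[symmetric])
          (auto simp: less_imp_le exp_of_nat_mult[symmetric])
      finally show ?thesis .
    qed
    with em ae show ?thesis by (auto intro!: finite_measureI simp: D_def)
  qed
  have fin2: "(\<integral>\<^sup>+y. ennreal (w y) \<partial>N2) < \<infinity>" using fin eq[of 0] by simp
  have DD: "D N1 = D N2"
    using D[OF sets(1) fin supp(1)] D[OF sets(2) fin2 supp(2)] eq by (intro finite_measure_eqI_moments) auto
  have recover: "emeasure N A = (\<integral>\<^sup>+z. ennreal (1 / w (- ln z)) * indicator A (- ln z) \<partial>D N)"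
    if N: "sets N = sets (restrict_space borel S)" and A: "A \<in> sets (restrict_space borel S)" for N A
  proof -
    have [measurable]: "A \<in> sets borel" using A S by (auto simp: sets_restrict_space_iff)
    have [measurable]: "w \<in> borel_measurable N" "(\<lambda>y. exp (- y)) \<in> borel_measurable N"
      by (rule mb[OF _ N(1)], measurable)+
    have "(\<integral>\<^sup>+z. ennreal (1 / w (- ln z)) * indicator A (- ln z) \<partial>D N)
        = (\<integral>\<^sup>+y. ennreal (w y) * (ennreal (1 / w y) * indicator A y) \<partial>N)"
      unfolding D_def by (subst nn_integral_distr) (auto simp: nn_integral_density mb[OF _ N(1)])
    also have "\<dots> = (\<integral>\<^sup>+y. indicator A y \<partial>N)"
      using w(2) sp[OF N(1)]
      by (intro nn_integral_cong)
        (auto simp: mult.assoc[symmetric] ennreal_mult''[symmetric] less_imp_le less_imp_neq[THEN not_sym])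
    also have "\<dots> = emeasure N A" using A N by simp
    finally show ?thesis by simp
  qed
  show ?thesis
    by (rule measure_eqI) (use recover sets DD in auto)
qed

text \<open>
  A measure on \<open>(0, \<infinity>)\<close> may have so much mass near 0 that its Laplace transform is infinite.
  Differences of two exponentials tame this, and the weight \<open>exp (- y) - exp (- 2 * y)\<close> times powers of
  \<open>exp (- y)\<close> is again such a difference.
\<close>

lemma measure_eqI_laplace_difference:
  fixes N1 N2 :: "real measure"
  assumes sets: "sets N1 = sets (restrict_space borel {0<..})" "sets N2 = sets (restrict_space borel {0<..})"
    and eq: "\<And>a b. 0 < a \<Longrightarrow> a \<le> b \<Longrightarrow> (\<integral>\<^sup>+y. ennreal (exp (- a * y) - exp (- b * y)) \<partial>N1)
                            = (\<integral>\<^sup>+y. ennreal (exp (- a * y) - exp (- b * y)) \<partial>N2)"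
    and fin: "\<And>a b. 0 < a \<Longrightarrow> a \<le> b \<Longrightarrow> (\<integral>\<^sup>+y. ennreal (exp (- a * y) - exp (- b * y)) \<partial>N1) < \<infinity>"
  shows "N1 = N2"
proof (rule measure_eqI_weighted_laplace[where S="{0<..}" and w="\<lambda>y. exp (- 1 * y) - exp (- 2 * y)"])
  have "(exp (- 1 * y) - exp (- 2 * y)) * exp (- real n * y) = exp (- (real n + 1) * y) - exp (- (real n + 2) * y)"
    for n y by (simp add: left_diff_distrib exp_add[symmetric] algebra_simps)
  then show "(\<integral>\<^sup>+y. ennreal ((exp (- 1 * y) - exp (- 2 * y)) * exp (- real n * y)) \<partial>N1)
      = (\<integral>\<^sup>+y. ennreal ((exp (- 1 * y) - exp (- 2 * y)) * exp (- real n * y)) \<partial>N2)" for n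
    using eq[of "real n + 1" "real n + 2"] by simp
  show "(\<integral>\<^sup>+y. ennreal (exp (- 1 * y) - exp (- 2 * y)) \<partial>N1) < \<infinity>" by (rule fin) auto
  have "AE y in N. 0 \<le> y" if "sets N = sets (restrict_space borel {0<..})" for N :: "real measure"
    using sets_eq_imp_space_eq[OF that] by (intro AE_I2) (simp add: space_restrict_space)
  then show "AE y in N1. 0 \<le> y" "AE y in N2. 0 \<le> y" using sets by auto
qed (use sets in auto)

section \<open>Elementary analysis\<close>

lemma exp_neg_le_linear: "0 \<le> s \<Longrightarrow> s \<le> 1 \<Longrightarrow> exp (- s) \<le> 1 - s / 2" for s :: real
proof -
  assume s: "0 \<le> s" "s \<le> 1"
  have "exp (- s) \<le> 1 / (1 + s)"
    using exp_ge_add_one_self[of s] s by (simp add: exp_minus inverse_eq_divide frac_le)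
  also have "\<dots> \<le> 1 - s / 2"
    using s mult_right_mono[of s 1 s] by (subst pos_divide_le_eq) (auto simp: algebra_simps)
  finally show ?thesis .
qed

lemma exp_neg_diff_le: "0 \<le> p \<Longrightarrow> p \<le> q \<Longrightarrow> exp (- p) - exp (- q) \<le> q - p" for p q :: real
proof -
  assume pq: "0 \<le> p" "p \<le> q"
  have "exp (- p) - exp (- q) = exp (- p) * (1 - exp (- (q - p)))"
    by (simp add: right_diff_distrib exp_add[symmetric])
  also have "\<dots> \<le> 1 * (q - p)"
  proof (rule mult_mono)
    show "1 - exp (- (q - p)) \<le> q - p" using exp_ge_add_one_self[of "- (q - p)"] by linarith
  qed (use pq in auto)
  finally show ?thesis by simp
qed

lemma exp_neg_Suc_mult_tendsto_zero:
  fixes y :: real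
  assumes "0 < y" shows "(\<lambda>n. exp (- real (Suc n) * y)) \<longlonglongrightarrow> 0"
proof -
  have "(\<lambda>n. exp (- real (Suc n) * y)) = (\<lambda>n. (exp (- y)) ^ Suc n)"
    by (simp add: exp_of_nat_mult[symmetric] del: of_nat_Suc power_Suc)
  moreover have "(\<lambda>n. (exp (- y)) ^ Suc n) \<longlonglongrightarrow> 0"
    using assms by (intro LIMSEQ_Suc LIMSEQ_power_zero) simp
  ultimately show ?thesis by simp
qed

text \<open>
  Nonnegativity makes the additive function monotone. Hence \<open>n * m t = m (n * t)\<close> lies between the
  multiples of \<open>m 1\<close> by the two integers around \<open>n * t\<close>, and dividing by a large \<open>n\<close> leaves no room.
\<close>

lemma additive_nonneg_imp_linear:
  fixes m :: "real \<Rightarrow> real"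
  assumes add: "\<And>s t. 0 \<le> s \<Longrightarrow> 0 \<le> t \<Longrightarrow> m (s + t) = m s + m t"
    and nonneg: "\<And>t. 0 \<le> t \<Longrightarrow> 0 \<le> m t" and t: "0 \<le> t"
  shows "m t = m 1 * t"
proof -
  have m0: "m 0 = 0" using add[of 0 0] by simp
  have mult: "m (real n * s) = real n * m s" if "0 \<le> s" for n s
    using that by (induction n) (auto simp: m0 add distrib_right)
  have mono: "m s \<le> m s'" if "0 \<le> s" "s \<le> s'" for s s'
    using add[of s "s' - s"] nonneg[of "s' - s"] that by simp
  have close: "real n * \<bar>m t - m 1 * t\<bar> \<le> m 1" for n
  proof -
    define k where "k = nat \<lfloor>real n * t\<rfloor>"
    have k: "real k \<le> real n * t" "real n * t \<le> real (Suc k)"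
      using t by (auto simp: k_def) linarith+
    have "m (real k * 1) \<le> m (real n * t)" "m (real n * t) \<le> m (real (Suc k) * 1)"
      using k t by (auto intro!: mono)
    then have "real k * m 1 \<le> real n * m t" "real n * m t \<le> real (Suc k) * m 1"
      using mult[of 1 k] mult[of 1 "Suc k"] mult[OF t, of n] by (auto simp del: of_nat_Suc)
    moreover have "real k * m 1 \<le> real n * t * m 1" "real n * t * m 1 \<le> real (Suc k) * m 1"
      using k nonneg[of 1] by (auto intro!: mult_right_mono)
    ultimately have "\<bar>real n * m t - real n * t * m 1\<bar> \<le> m 1" by (simp add: algebra_simps abs_le_iff)
    moreover have "real n * m t - real n * t * m 1 = real n * (m t - m 1 * t)" by (simp add: algebra_simps)
    ultimately show ?thesis by (simp add: abs_mult)
  qed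
  show ?thesis
  proof (rule ccontr)
    assume "m t \<noteq> m 1 * t"
    then obtain n :: nat where "m 1 < real n * \<bar>m t - m 1 * t\<bar>"
      using reals_Archimedean3[of "\<bar>m t - m 1 * t\<bar>"] by auto
    then show False using close[of n] by simp
  qed
qed

lemma antiderivative_on_half_line:
  fixes f :: "real \<Rightarrow> real"
  assumes "continuous_on {0<..} f"
  shows "\<exists>F. \<forall>l>0. (F has_real_derivative f l) (at l)"
proof -
  have "\<exists>F. \<forall>x::real. 0 < ereal x \<longrightarrow> ereal x < \<infinity> \<longrightarrow> (F has_vector_derivative f x) (at x)"
    using assms by (intro einterval_antiderivative) (auto simp: continuous_on_eq_continuous_at)
  then show ?thesis by (auto simp: has_real_derivative_iff_has_vector_derivative)
qed

text \<open>
  Tonelli's theorem, with \<open>exp (- a * y) - exp (- b * y)\<close> written as the integral of \<open>y * exp (- l * y)\<close>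
  over \<open>l\<close> from \<open>a\<close> to \<open>b\<close>. This is where the factor \<open>1 / y\<close> in both densities comes from.
\<close>

lemma nn_integral_Laplace_difference:
  fixes h :: "real \<Rightarrow> real"
  assumes [measurable]: "h \<in> borel_measurable borel" and h: "\<And>y. 0 < y \<Longrightarrow> 0 \<le> h y"
    and ab: "a \<le> b"
  shows "(\<integral>\<^sup>+y\<in>{0<..}. ennreal ((exp (- a * y) - exp (- b * y)) * (h y / y)) \<partial>lborel)
       = (\<integral>\<^sup>+l\<in>{a..b}. (\<integral>\<^sup>+y\<in>{0<..}. ennreal (exp (- l * y) * h y) \<partial>lborel) \<partial>lborel)"
proof -
  have inner: "ennreal ((exp (- a * y) - exp (- b * y)) * (h y / y)) * indicator {0<..} y
      = (\<integral>\<^sup>+l. ennreal (exp (- l * y) * h y) * indicator {0<..} y * indicator {a..b} l \<partial>lborel)" for y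
  proof (cases "0 < y")
    case y: True
    have "(\<integral>\<^sup>+l. ennreal (exp (- l * y) * h y) * indicator {a..b} l \<partial>lborel)
        = ennreal (- exp (- b * y) * (h y / y) - - exp (- a * y) * (h y / y))"
    proof (rule nn_integral_FTC_Icc)
      show "((\<lambda>l. - exp (- l * y) * (h y / y)) has_real_derivative exp (- x * y) * h y) (at x)" for x
        using y by (auto intro!: derivative_eq_intros)
    qed (use h[OF y] ab in auto)
    then show ?thesis using y by (simp add: algebra_simps diff_divide_distrib)
  qed simp
  have "(\<integral>\<^sup>+y\<in>{0<..}. ennreal ((exp (- a * y) - exp (- b * y)) * (h y / y)) \<partial>lborel)
      = (\<integral>\<^sup>+l. (\<integral>\<^sup>+y. ennreal (exp (- l * y) * h y) * indicator {0<..} y * indicator {a..b} l \<partial>lborel) \<partial>lborel)"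
    unfolding inner by (rule lborel_pair.Fubini') measurable
  also have "\<dots> = (\<integral>\<^sup>+l\<in>{a..b}. (\<integral>\<^sup>+y\<in>{0<..}. ennreal (exp (- l * y) * h y) \<partial>lborel) \<partial>lborel)"
    by (intro nn_integral_cong) (subst nn_integral_multc[symmetric], auto)
  finally show ?thesis .
qed

section \<open>The scale function\<close>

text \<open>
  Positivity and continuity of \<open>\<psi>\<close>, and its behaviour at 0, are read off from the fact that \<open>1 / \<psi>\<close> is
  the Laplace transform of \<open>W\<close>.
\<close>

locale scale_pair =
  fixes \<psi> W :: "real \<Rightarrow> real"
  assumes scale: "scale_function \<psi> W" and psi_zero: "\<psi> 0 = 0"
begin

lemma W_neg: "x < 0 \<Longrightarrow> W x = 0" and W_nonneg: "0 \<le> W x" 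
  using scale unfolding scale_function_def by (force, metis linorder_not_le order_refl)

lemma W_less: "0 \<le> x \<Longrightarrow> x < y \<Longrightarrow> W x < W y"
  using scale unfolding scale_function_def by (auto simp: strict_mono_on_def)

lemma W_pos: "0 < x \<Longrightarrow> 0 < W x"
  using W_less[of 0 x] W_nonneg[of 0] by simp

lemma W_mono: "x \<le> y \<Longrightarrow> W x \<le> W y"
  using W_less[of x y] W_neg[of x] W_nonneg[of y] by (cases "x = y"; cases "x < 0") auto

lemma W_measurable[measurable]: "W \<in> borel_measurable borel"
  by (rule borel_measurable_mono) (simp add: W_mono monoI)

lemma W_laplace:
  assumes "0 < l"
  shows "integrable lborel (\<lambda>y. exp (- l * y) * W y)"
    and "(\<integral>y. exp (- l * y) * W y \<partial>lborel) = 1 / \<psi> l"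
proof -
  have eq: "indicator {0..} y *\<^sub>R (exp (- l * y) * W y) = exp (- l * y) * W y" for y
    using W_neg[of y] by (auto split: split_indicator)
  have "set_integrable lborel {0..} (\<lambda>y. exp (- l * y) * W y)"
    "(LINT y:{0..}|lborel. exp (- l * y) * W y) = 1 / \<psi> l"
    using scale assms unfolding scale_function_def by auto
  then show "integrable lborel (\<lambda>y. exp (- l * y) * W y)" "(\<integral>y. exp (- l * y) * W y \<partial>lborel) = 1 / \<psi> l"
    unfolding set_integrable_def set_lebesgue_integral_def eq by auto
qed

lemma nn_W_laplace:
  assumes "0 < l"
  shows "(\<integral>\<^sup>+y. ennreal (exp (- l * y) * W y) \<partial>lborel) = ennreal (1 / \<psi> l)"
  using nn_integral_eq_integral[OF W_laplace(1)[OF assms]] W_laplace(2)[OF assms] W_nonneg by simp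

text \<open>
  As \<open>W \<ge> W 1 > 0\<close> on \<open>[1, \<infinity>)\<close>, the transform of \<open>W\<close> is at least of order \<open>1 / z\<close> at 0. So \<open>\<psi>\<close> is at
  most linear there, which keeps the flow from reaching 0 in finite time.
\<close>

lemma inverse_psi_lower_bound:
  assumes z: "0 < z"
  shows "W 1 * exp (- z) / z \<le> 1 / \<psi> z"
proof -
  have "(\<integral>\<^sup>+y. ennreal (W 1 * exp (- z * y)) * indicator {1..} y \<partial>lborel) = ennreal (0 - - W 1 * exp (- z * 1) / z)"
  proof (rule nn_integral_FTC_atLeast[where F="\<lambda>y. - W 1 * exp (- z * y) / z"])
    show "((\<lambda>y. - W 1 * exp (- z * y) / z) has_real_derivative W 1 * exp (- z * y)) (at y)" for y
      using z by (auto intro!: derivative_eq_intros)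
    have "((\<lambda>y. exp (- z * y)) \<longlongrightarrow> 0) at_top"
      using z by (intro filterlim_compose[OF exp_at_bot] filterlim_tendsto_neg_mult_at_bot[OF tendsto_const _ filterlim_ident]) auto
    from tendsto_mult[OF tendsto_const[of "- W 1 / z"] this] show "((\<lambda>y. - W 1 * exp (- z * y) / z) \<longlongrightarrow> 0) at_top" by simp
  qed (auto simp: W_nonneg)
  moreover have "(\<integral>\<^sup>+y. ennreal (W 1 * exp (- z * y)) * indicator {1..} y \<partial>lborel)
      \<le> (\<integral>\<^sup>+y. ennreal (exp (- z * y) * W y) \<partial>lborel)"
    by (intro nn_integral_mono) (auto split: split_indicator intro!: ennreal_leI simp: W_mono mult.commute)
  ultimately have "ennreal (W 1 * exp (- z) / z) \<le> ennreal (1 / \<psi> z)" using nn_W_laplace[OF z] by simp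
  moreover have "0 \<le> 1 / \<psi> z"
    unfolding W_laplace(2)[OF z, symmetric] by (rule integral_nonneg_AE) (auto simp: W_nonneg)
  ultimately show ?thesis by simp
qed

lemma psi_pos: assumes "0 < z" shows "0 < \<psi> z"
proof -
  have "0 < W 1 * exp (- z) / z" using assms W_pos[of 1] by simp
  then have "0 < 1 / \<psi> z" using inverse_psi_lower_bound[OF assms] by linarith
  then show ?thesis by simp
qed

lemma psi_nonneg: "0 \<le> z \<Longrightarrow> 0 \<le> \<psi> z"
  using psi_pos[of z] psi_zero by (cases "z = 0") auto

lemma psi_le_linear:
  assumes "0 \<le> z" "z \<le> m" shows "\<psi> z \<le> exp m / W 1 * z"
proof (cases "z = 0")
  case False
  then have z: "0 < z" using assms by simp
  have "\<psi> z \<le> z * exp z / W 1"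
    using inverse_psi_lower_bound[OF z] psi_pos[OF z] W_pos[of 1] z by (simp add: field_simps exp_minus)
  also have "\<dots> \<le> z * exp m / W 1" using assms W_pos[of 1] by (intro divide_right_mono mult_left_mono) auto
  finally show ?thesis by (simp add: mult.commute)
qed (simp add: psi_zero)

lemma inverse_psi_continuous: "continuous_on {0<..} (\<lambda>l. 1 / \<psi> l)"
proof -
  have *: "continuous_on {a..} (\<lambda>l. 1 / \<psi> l)" if a: "0 < a" for a
    unfolding continuous_on_sequentially
  proof (intro allI ballI impI, elim conjE)
    fix x l assume x: "\<forall>n. x n \<in> {a..}" and l: "l \<in> {a..}" and lim: "x \<longlonglongrightarrow> l"
    have "(\<lambda>n. \<integral>y. exp (- x n * y) * W y \<partial>lborel) \<longlonglongrightarrow> (\<integral>y. exp (- l * y) * W y \<partial>lborel)"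
    proof (rule integral_dominated_convergence[where w="\<lambda>y. exp (- a * y) * W y"])
      show "AE y in lborel. (\<lambda>n. exp (- x n * y) * W y) \<longlonglongrightarrow> exp (- l * y) * W y"
        by (intro AE_I2 tendsto_intros lim)
      show "AE y in lborel. norm (exp (- x n * y) * W y) \<le> exp (- a * y) * W y" for n
      proof (intro AE_I2)
        fix y show "norm (exp (- x n * y) * W y) \<le> exp (- a * y) * W y"
          using x W_neg[of y] W_nonneg[of y]
          by (cases "y < 0") (auto simp: abs_mult intro!: mult_right_mono mult_left_mono)
      qed
    qed (use W_laplace[OF a] in auto)
    moreover have "0 < x n" "0 < l" for n using x l a by (auto intro: less_le_trans)
    ultimately show "((\<lambda>l. 1 / \<psi> l) \<circ> x) \<longlonglongrightarrow> 1 / \<psi> l"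
      by (simp only: W_laplace(2) o_def)
  qed
  show ?thesis
    unfolding continuous_on_eq_continuous_at[OF open_greaterThan]
  proof
    fix l :: real assume "l \<in> {0<..}"
    then show "isCont (\<lambda>l. 1 / \<psi> l) l"
      using *[of "l/2"] by (intro continuous_on_interior[of "{l/2..}"]) auto
  qed
qed

text \<open>
  The flow needs time \<open>clock b - clock a\<close> to descend from \<open>b\<close> to \<open>a\<close>; the additive constant is
  arbitrary.
\<close>

definition clock :: "real \<Rightarrow> real" where
  "clock = (SOME f. \<forall>l>0. (f has_real_derivative 1 / \<psi> l) (at l))"

lemma clock_deriv: "0 < l \<Longrightarrow> (clock has_real_derivative 1 / \<psi> l) (at l)"
  using someI_ex[OF antiderivative_on_half_line[OF inverse_psi_continuous]] unfolding clock_def by blast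

lemma clock_less: assumes "0 < a" "a < b" shows "clock a < clock b"
  using assms by (intro DERIV_pos_imp_increasing[OF assms(2)]) (meson clock_deriv psi_pos assms(1) divide_pos_pos less_le_trans zero_less_one)

lemma clock_le_iff: "0 < a \<Longrightarrow> 0 < b \<Longrightarrow> clock a \<le> clock b \<longleftrightarrow> a \<le> b"
  using clock_less[of a b] clock_less[of b a] by (cases a b rule: linorder_cases) auto

lemma clock_eq_iff: "0 < a \<Longrightarrow> 0 < b \<Longrightarrow> clock a = clock b \<longleftrightarrow> a = b"
  using clock_le_iff[of a b] clock_le_iff[of b a] by auto

lemma inverse_psi_measurable: "(\<lambda>l. 1 / \<psi> l * indicator {0<..} l) \<in> borel_measurable borel"
  using borel_measurable_continuous_on_indicator[OF _ inverse_psi_continuous] by (simp add: mult.commute)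

definition \<mu> :: "real measure" where
  "\<mu> = density (restrict_space lborel {0<..}) (\<lambda>y. ennreal (W y / y))"

lemma sets_mu: "sets \<mu> = sets (restrict_space borel {0<..})"
  by (simp add: \<mu>_def sets_restrict_space)

lemma nn_integral_mu:
  assumes [measurable]: "f \<in> borel_measurable borel" and f: "\<And>y. 0 < y \<Longrightarrow> 0 \<le> f y"
  shows "(\<integral>\<^sup>+y. ennreal (f y) \<partial>\<mu>) = (\<integral>\<^sup>+y\<in>{0<..}. ennreal (f y * (W y / y)) \<partial>lborel)"
proof -
  have "(\<integral>\<^sup>+y. ennreal (f y) \<partial>\<mu>) = (\<integral>\<^sup>+y\<in>{0<..}. ennreal (W y / y) * ennreal (f y) \<partial>lborel)"
    unfolding \<mu>_def
    by (subst nn_integral_density) (auto intro!: measurable_restrict_space1 simp: nn_integral_restrict_space)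
  also have "\<dots> = (\<integral>\<^sup>+y\<in>{0<..}. ennreal (f y * (W y / y)) \<partial>lborel)"
    using f W_nonneg by (intro nn_integral_cong) (auto split: split_indicator simp: ennreal_mult'[symmetric] mult.commute)
  finally show ?thesis .
qed

text \<open>
  Integrating against \<open>\<mu>\<close> measures clock distances of exponents. Stationarity of \<open>\<mu>\<close> and uniqueness
  both rest on this.
\<close>

lemma mu_laplace_difference:
  assumes "0 < a" "a \<le> b"
  shows "(\<integral>\<^sup>+y. ennreal (exp (- a * y) - exp (- b * y)) \<partial>\<mu>) = ennreal (clock b - clock a)"
proof -
  have "(\<integral>\<^sup>+y. ennreal (exp (- a * y) - exp (- b * y)) \<partial>\<mu>)
     = (\<integral>\<^sup>+y\<in>{0<..}. ennreal ((exp (- a * y) - exp (- b * y)) * (W y / y)) \<partial>lborel)"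
    using assms by (intro nn_integral_mu) auto
  also have "\<dots> = (\<integral>\<^sup>+l\<in>{a..b}. (\<integral>\<^sup>+y\<in>{0<..}. ennreal (exp (- l * y) * W y) \<partial>lborel) \<partial>lborel)"
    using assms W_nonneg by (intro nn_integral_Laplace_difference) auto
  also have "\<dots> = (\<integral>\<^sup>+l. ennreal (1 / \<psi> l * indicator {0<..} l) * indicator {a..b} l \<partial>lborel)"
  proof (intro nn_integral_cong)
    fix l
    have "(\<integral>\<^sup>+y\<in>{0<..}. ennreal (exp (- l * y) * W y) \<partial>lborel) = ennreal (1 / \<psi> l)" if "0 < l"
      unfolding nn_W_laplace[OF that, symmetric]
      by (intro nn_integral_cong_AE, use AE_lborel_singleton[of 0] in eventually_elim)
        (auto split: split_indicator simp: W_neg)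
    then show "(\<integral>\<^sup>+y\<in>{0<..}. ennreal (exp (- l * y) * W y) \<partial>lborel) * indicator {a..b} l
      = ennreal (1 / \<psi> l * indicator {0<..} l) * indicator {a..b} l"
      using assms by (auto split: split_indicator)
  qed
  also have "\<dots> = ennreal (clock b - clock a)"
    using assms by (intro nn_integral_FTC_Icc inverse_psi_measurable)
      (auto simp: clock_deriv psi_pos less_imp_le)
  finally show ?thesis .
qed

text \<open>
  Grey's condition: the flow comes down from infinity in finite time.
\<close>

lemma clock_bounded_above:
  assumes "\<exists>c>0. set_integrable lborel {c..} (\<lambda>l. 1 / \<psi> l)"
  obtains B where "\<And>l. 0 < l \<Longrightarrow> clock l \<le> B"
proof -
  obtain c where c: "0 < c" "set_integrable lborel {c..} (\<lambda>l. 1 / \<psi> l)" using assms by auto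
  define I where "I = (\<integral>l. indicator {c..} l *\<^sub>R (1 / \<psi> l) \<partial>lborel)"
  have I: "(\<integral>\<^sup>+l. ennreal (indicator {c..} l *\<^sub>R (1 / \<psi> l)) \<partial>lborel) = ennreal I"
    unfolding I_def using c by (intro nn_integral_eq_integral)
      (auto simp: set_integrable_def psi_pos less_imp_le split: split_indicator)
  have "I \<ge> 0" unfolding I_def using c(1)
    by (intro integral_nonneg_AE) (auto simp: psi_pos less_imp_le split: split_indicator)
  have *: "clock l \<le> clock c + I" if l: "c \<le> l" for l
  proof -
    have "ennreal (clock l - clock c) = (\<integral>\<^sup>+l'. ennreal (1 / \<psi> l' * indicator {0<..} l') * indicator {c..l} l' \<partial>lborel)"
      using l c(1) by (intro nn_integral_FTC_Icc[symmetric] inverse_psi_measurable)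
        (auto simp: clock_deriv psi_pos less_imp_le)
    also have "\<dots> \<le> (\<integral>\<^sup>+l. ennreal (indicator {c..} l *\<^sub>R (1 / \<psi> l)) \<partial>lborel)"
      using c(1) by (intro nn_integral_mono) (auto split: split_indicator)
    finally show ?thesis using I \<open>I \<ge> 0\<close> by simp
  qed
  have "clock l \<le> clock c + I" if "0 < l" for l
    using *[of l] *[of c] clock_le_iff[of l c] that c(1) \<open>I \<ge> 0\<close> by (cases "c \<le> l") auto
  then show ?thesis by (rule that)
qed

end

section \<open>The cumulant flow\<close>

text \<open>
  At time 0 the flow is differentiable from the right only, while the mean value and fundamental
  theorems below use derivatives on a full neighbourhood. Continuing linearly to the left repairs this.
\<close>

lemma extend_differentiable_beyond_zero:
  fixes f D :: "real \<Rightarrow> real"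
  assumes f: "\<And>t. 0 \<le> t \<Longrightarrow> (f has_real_derivative D t) (at t within {0..})"
  obtains g where "\<And>t. 0 \<le> t \<Longrightarrow> g t = f t" "\<And>t. 0 \<le> t \<Longrightarrow> (g has_real_derivative D t) (at t)"
proof
  define g where "g t = (if 0 \<le> t then f t else f 0 + D 0 * t)" for t
  show "g t = f t" if "0 \<le> t" for t using that by (simp add: g_def)
  show "(g has_real_derivative D t) (at t)" if t: "0 \<le> t" for t
  proof (cases "t = 0")
    case True
    have "((\<lambda>y. (g y - g 0) / (y - 0)) \<longlongrightarrow> D 0) (at 0)"
    proof (rule filterlim_split_at)
      have "((\<lambda>y. (f y - f 0) / (y - 0)) \<longlongrightarrow> D 0) (at_right 0)"
        using f[of 0] by (simp add: has_field_derivative_iff at_within_Ici_at_right)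
      moreover have "\<forall>\<^sub>F y in at_right 0. (f y - f 0) / (y - 0) = (g y - g 0) / (y - 0)"
        by (auto simp: eventually_at_filter g_def)
      ultimately show "((\<lambda>y. (g y - g 0) / (y - 0)) \<longlongrightarrow> D 0) (at_right 0)"
        by (rule Lim_transform_eventually)
      have "\<forall>\<^sub>F y in at_left 0. D 0 = (g y - g 0) / (y - 0)"
        by (auto simp: eventually_at_filter g_def)
      then show "((\<lambda>y. (g y - g 0) / (y - 0)) \<longlongrightarrow> D 0) (at_left 0)"
        by (rule Lim_transform_eventually[OF tendsto_const])
    qed
    then show ?thesis using True by (simp add: has_field_derivative_iff)
  next
    case False
    then have "0 < t" using t by simp
    then have "at t within {0..} = at t" by (intro at_within_interior) simp
    then have "(f has_real_derivative D t) (at t)" using f[OF t] by simp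
    moreover have "\<forall>\<^sub>F y in nhds t. f y = g y"
      using eventually_nhds_in_open[of "{0<..}" t] \<open>0 < t\<close> by (auto elim!: eventually_mono simp: g_def)
    moreover have "f t = g t" using t by (simp add: g_def)
    ultimately show ?thesis by (simp add: DERIV_cong_ev[OF refl])
  qed
qed

locale scale_flow = scale_pair +
  fixes u :: "real \<Rightarrow> real \<Rightarrow> real"
  assumes flow: "cumulant_flow \<psi> u"
    and grey: "\<exists>c>0. set_integrable lborel {c..} (\<lambda>l. 1 / \<psi> l)"
begin

lemma u_zero: "0 < l \<Longrightarrow> u 0 l = l"
  and u_nonneg: "0 < l \<Longrightarrow> 0 \<le> t \<Longrightarrow> 0 \<le> u t l"
  and u_deriv: "0 < l \<Longrightarrow> 0 \<le> t \<Longrightarrow> ((\<lambda>s. u s l) has_real_derivative - \<psi> (u t l)) (at t within {0..})"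
  using flow unfolding cumulant_flow_def by blast+

lemma u_extension:
  assumes "0 < l"
  obtains g where "\<And>t. 0 \<le> t \<Longrightarrow> g t = u t l" "\<And>t. 0 \<le> t \<Longrightarrow> (g has_real_derivative - \<psi> (u t l)) (at t)"
  using extend_differentiable_beyond_zero[OF u_deriv[OF assms]] by blast

lemma u_continuous: "0 < l \<Longrightarrow> continuous_on {0..} (\<lambda>t. u t l)"
  unfolding continuous_on_eq_continuous_within by (auto intro!: DERIV_continuous u_deriv)

lemma u_antimono:
  assumes l: "0 < l" and "0 \<le> s" "s \<le> t" shows "u t l \<le> u s l"
proof -
  obtain g where g: "\<And>t. 0 \<le> t \<Longrightarrow> g t = u t l" "\<And>t. 0 \<le> t \<Longrightarrow> (g has_real_derivative - \<psi> (u t l)) (at t)"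
    using u_extension[OF l] by blast
  have "g t \<le> g s"
  proof (rule DERIV_nonpos_imp_nonincreasing[OF \<open>s \<le> t\<close>])
    fix x assume "s \<le> x" "x \<le> t"
    then have "0 \<le> x" using assms by simp
    then show "\<exists>y. (g has_real_derivative y) (at x) \<and> y \<le> 0"
      using g(2) psi_nonneg[OF u_nonneg[OF l]] by (intro exI[of _ "- \<psi> (u x l)"]) auto
  qed
  then show ?thesis using g(1) assms by simp
qed

lemma u_le: "0 < l \<Longrightarrow> 0 \<le> t \<Longrightarrow> u t l \<le> l"
  using u_antimono[of l 0 t] u_zero by simp

text \<open>
  While \<open>u\<close> stays below its starting point \<open>l\<close>, linear growth of \<open>\<psi>\<close> gives \<open>\<psi> u \<le> C * u\<close>, so
  \<open>u t l * exp (C * t)\<close> does not decrease.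
\<close>

lemma u_pos:
  assumes l: "0 < l" and t: "0 \<le> t" shows "0 < u t l"
proof -
  obtain g where g: "\<And>t. 0 \<le> t \<Longrightarrow> g t = u t l" "\<And>t. 0 \<le> t \<Longrightarrow> (g has_real_derivative - \<psi> (u t l)) (at t)"
    using u_extension[OF l] by blast
  define C where "C = exp l / W 1"
  have "g 0 * exp (C * 0) \<le> g t * exp (C * t)"
  proof (rule DERIV_nonneg_imp_nondecreasing[OF t])
    fix x assume x: "0 \<le> x" "x \<le> t"
    have "((\<lambda>t. g t * exp (C * t)) has_real_derivative (C * u x l - \<psi> (u x l)) * exp (C * x)) (at x)"
      using x by (auto intro!: derivative_eq_intros g(2) simp: g(1) algebra_simps)
    moreover have "\<psi> (u x l) \<le> C * u x l"
      unfolding C_def by (rule psi_le_linear[OF u_nonneg[OF l x(1)] u_le[OF l x(1)]])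
    ultimately show "\<exists>y. ((\<lambda>t. g t * exp (C * t)) has_real_derivative y) (at x) \<and> 0 \<le> y" by fastforce
  qed
  then have "l \<le> u t l * exp (C * t)" using g(1) u_zero[OF l] t by simp
  then have "0 < u t l * exp (C * t)" using l by linarith
  then show ?thesis by (simp add: zero_less_mult_iff)
qed

text \<open>
  By the chain rule \<open>clock (u t l)\<close> has derivative \<open>1 / \<psi> u * (- \<psi> u) = - 1\<close>. All further properties of
  the flow are consequences of this formula and of the strict monotonicity of the clock.
\<close>

lemma clock_flow:
  assumes l: "0 < l" and t: "0 \<le> t" shows "clock (u t l) = clock l - t"
proof (cases "t = 0")
  case False
  obtain g where g: "\<And>t. 0 \<le> t \<Longrightarrow> g t = u t l" "\<And>t. 0 \<le> t \<Longrightarrow> (g has_real_derivative - \<psi> (u t l)) (at t)"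
    using u_extension[OF l] by blast
  have d: "((\<lambda>t. clock (g t) + t) has_real_derivative 0) (at x)" if x: "0 \<le> x" for x
  proof -
    have "((\<lambda>t. clock (g t)) has_real_derivative 1 / \<psi> (g x) * (- \<psi> (u x l))) (at x)"
      by (rule DERIV_chain2[OF clock_deriv g(2)[OF x]]) (simp add: g(1) x u_pos[OF l])
    from DERIV_add[OF this DERIV_ident] show ?thesis
      using psi_pos[OF u_pos[OF l x]] by (simp add: g(1) x)
  qed
  have "clock (g t) + t = clock (g 0) + 0"
    using t False by (intro DERIV_isconst2[of 0 t "\<lambda>t. clock (g t) + t" t])
      (auto intro!: d continuous_at_imp_continuous_on DERIV_isCont)
  then show ?thesis using g(1) t u_zero[OF l] by simp
qed (simp add: u_zero l)

lemma u_mono: "0 < l \<Longrightarrow> l \<le> m \<Longrightarrow> 0 \<le> t \<Longrightarrow> u t l \<le> u t m"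
  using clock_le_iff[of "u t l" "u t m"] clock_le_iff[of l m] by (simp add: clock_flow u_pos)

lemma u_eqI: "0 < l \<Longrightarrow> 0 < m \<Longrightarrow> 0 \<le> t \<Longrightarrow> t = clock l - clock m \<Longrightarrow> u t l = m"
  using clock_eq_iff[of "u t l" m] by (simp add: clock_flow u_pos)

lemma u_semigroup: "0 < l \<Longrightarrow> 0 \<le> s \<Longrightarrow> 0 \<le> t \<Longrightarrow> u s (u t l) = u (s + t) l"
  using clock_eq_iff[of "u s (u t l)" "u (s + t) l"] by (simp add: clock_flow u_pos)

lemma u_tendsto_zero:
  assumes l: "0 < l" shows "((\<lambda>t. u t l) \<longlongrightarrow> 0) at_top"
proof (rule tendstoI)
  fix e :: real assume e: "0 < e"
  show "\<forall>\<^sub>F t in at_top. dist (u t l) 0 < e"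
    using eventually_gt_at_top[of "max 0 (clock l - clock e)"]
  proof eventually_elim
    case (elim t)
    then have "clock (u t l) < clock e" using clock_flow[OF l, of t] by simp
    then show ?case using clock_le_iff[of e "u t l"] e u_pos[OF l, of t] elim by (auto simp: not_le)
  qed
qed

text \<open>
  This is \<open>u t\<close> at infinity, usually characterised by \<open>P x (Z t = 0) = exp (- x * v t)\<close>; see \<open>law_zero\<close>.
\<close>

definition v :: "real \<Rightarrow> real" where "v t = (SUP l\<in>{0<..}. u t l)"

text \<open>
  At time \<open>t\<close> the flow is at least \<open>t\<close> below the supremum of the clock, wherever it started.
\<close>

lemma u_bounded:
  assumes t: "0 < t" shows "\<exists>m>0. \<forall>l>0. u t l \<le> m"
proof -
  obtain B where B: "\<And>l. 0 < l \<Longrightarrow> clock l \<le> B" using clock_bounded_above[OF grey] by blast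
  have bdd: "bdd_above (clock ` {0<..})" using B by (auto simp: bdd_above_def)
  have "(SUP l\<in>{0<..}. clock l) - t < (SUP l\<in>{0<..}. clock l)" using t by simp
  then obtain m where m: "0 < m" "(SUP l\<in>{0<..}. clock l) - t < clock m"
    using less_cSUP_iff[OF _ bdd] by auto
  have "u t l \<le> m" if l: "0 < l" for l
  proof -
    have "clock l \<le> (SUP l\<in>{0<..}. clock l)" using l by (intro cSUP_upper bdd) auto
    then have "clock (u t l) \<le> clock m" using m clock_flow[OF l, of t] t by simp
    then show ?thesis using clock_le_iff u_pos[OF l, of t] m t by simp
  qed
  then show ?thesis using m by auto
qed

lemma u_bdd_above: "0 < t \<Longrightarrow> bdd_above (u t ` {0<..})"
  using u_bounded[of t] by (auto simp: bdd_above_def)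

lemma u_le_v: assumes "0 < t" "0 < l" shows "u t l \<le> v t"
  unfolding v_def using assms by (intro cSUP_upper u_bdd_above) auto

lemma v_pos: "0 < t \<Longrightarrow> 0 < v t"
  using u_le_v[of t 1] u_pos[of 1 t] by simp

lemma u_tendsto_v:
  assumes t: "0 < t" shows "(u t \<longlongrightarrow> v t) at_top"
proof (rule increasing_tendsto)
  show "\<forall>\<^sub>F l in at_top. u t l \<le> v t"
    using eventually_gt_at_top[of 0] by eventually_elim (rule u_le_v[OF t])
  fix x assume "x < v t"
  then obtain m where m: "0 < m" "x < u t m"
    unfolding v_def using less_cSUP_iff[OF _ u_bdd_above[OF t], of x] by auto
  show "\<forall>\<^sub>F l in at_top. x < u t l"
    using eventually_ge_at_top[of m] by eventually_elim (use m u_mono[of m _ t] t in fastforce)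
qed

text \<open>
  If \<open>t\<close> exceeds what the clock has left above \<open>l\<close>, then every trajectory is below \<open>l\<close> at time \<open>t\<close>.
\<close>

lemma v_small:
  assumes l: "0 < l" shows "\<exists>t>0. v t \<le> l"
proof -
  obtain B where B: "\<And>l. 0 < l \<Longrightarrow> clock l \<le> B" using clock_bounded_above[OF grey] by blast
  define t where "t = B - clock l + 1"
  have t: "0 < t" using B[OF l] by (simp add: t_def)
  have "u t m \<le> l" if m: "0 < m" for m
    using clock_le_iff[of "u t m" l] clock_flow[OF m, of t] B[OF m] t l u_pos[OF m, of t] by (simp add: t_def)
  then have "v t \<le> l" unfolding v_def by (intro cSUP_least) auto
  then show ?thesis using t by blast
qed

text \<open>
  Substitution \<open>l = u t a\<close>. With an antiderivative \<open>J\<close> of \<open>(1 - exp (- x * l)) / \<psi> l\<close>, the derivative of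
  \<open>J (u t a)\<close> in \<open>t\<close> is \<open>exp (- x * u t a) - 1\<close>. The time integral of this alone may diverge, which is
  why two exponents are subtracted before integrating.
\<close>

lemma nn_integral_time_flow_difference:
  assumes ab: "0 < a" "a \<le> b" and x: "0 \<le> x"
  shows "(\<integral>\<^sup>+t\<in>{0..}. ennreal (exp (- x * u t a) - exp (- x * u t b)) \<partial>lborel)
       = (\<integral>\<^sup>+l\<in>{a..b}. ennreal ((1 - exp (- x * l)) * (1 / \<psi> l)) \<partial>lborel)"
proof -
  have b: "0 < b" using ab by simp
  have cont: "continuous_on {0<..} (\<lambda>l. (1 - exp (- x * l)) * (1 / \<psi> l))"
    by (intro continuous_intros inverse_psi_continuous)
  obtain J where J: "\<And>l. 0 < l \<Longrightarrow> (J has_real_derivative (1 - exp (- x * l)) * (1 / \<psi> l)) (at l)"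
    using antiderivative_on_half_line[OF cont] by blast
  obtain ga where ga: "\<And>t. 0 \<le> t \<Longrightarrow> ga t = u t a" "\<And>t. 0 \<le> t \<Longrightarrow> (ga has_real_derivative - \<psi> (u t a)) (at t)"
    using u_extension[OF ab(1)] by blast
  obtain gb where gb: "\<And>t. 0 \<le> t \<Longrightarrow> gb t = u t b" "\<And>t. 0 \<le> t \<Longrightarrow> (gb has_real_derivative - \<psi> (u t b)) (at t)"
    using u_extension[OF b] by blast
  have dJ: "((\<lambda>t. J (g t)) has_real_derivative exp (- x * u t l) - 1) (at t)"
    if l: "0 < l" and t: "0 \<le> t" and g: "g t = u t l" "(g has_real_derivative - \<psi> (u t l)) (at t)" for g l t
  proof -
    have "((\<lambda>t. J (g t)) has_real_derivative (1 - exp (- x * g t)) * (1 / \<psi> (g t)) * (- \<psi> (u t l))) (at t)"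
      by (rule DERIV_chain2[OF J g(2)]) (simp add: g(1) t u_pos[OF l])
    then show ?thesis using psi_pos[OF u_pos[OF l t]] by (simp add: g(1))
  qed
  have J_le: "J d - J c \<le> x * d * (clock d - clock c)" if cd: "0 < c" "c \<le> d" for c d
  proof -
    have "x * d * clock c - J c \<le> x * d * clock d - J d"
    proof (rule DERIV_nonneg_imp_nondecreasing[OF cd(2)])
      fix l assume l: "c \<le> l" "l \<le> d"
      then have l0: "0 < l" using cd by simp
      have "((\<lambda>l. x * d * clock l - J l) has_real_derivative x * d * (1 / \<psi> l) - (1 - exp (- x * l)) * (1 / \<psi> l)) (at l)"
        by (intro derivative_intros DERIV_cmult clock_deriv J l0)
      moreover have "1 - exp (- x * l) \<le> x * d"
        using exp_ge_add_one_self[of "- x * l"] mult_left_mono[OF l(2) x] by simp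
      then have "0 \<le> x * d * (1 / \<psi> l) - (1 - exp (- x * l)) * (1 / \<psi> l)"
        unfolding left_diff_distrib[symmetric] using psi_pos[OF l0] by simp
      ultimately show "\<exists>y. ((\<lambda>l. x * d * clock l - J l) has_real_derivative y) (at l) \<and> 0 \<le> y" by blast
    qed
    then show ?thesis by (simp add: right_diff_distrib)
  qed
  have J_mono: "J c \<le> J d" if cd: "0 < c" "c \<le> d" for c d
  proof (rule DERIV_nonneg_imp_nondecreasing[OF cd(2)])
    fix l assume l: "c \<le> l" "l \<le> d"
    then have l0: "0 < l" using cd by simp
    have "0 \<le> (1 - exp (- x * l)) * (1 / \<psi> l)" using psi_pos[OF l0] x l0 by simp
    then show "\<exists>y. (J has_real_derivative y) (at l) \<and> 0 \<le> y" using J[OF l0] by blast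
  qed
  \<comment> \<open>both trajectories tend to 0 at constant clock distance, and below level \<open>d\<close> the function
    \<open>J\<close> grows at most \<open>x * d\<close> times as fast as the clock\<close>
  have lim: "((\<lambda>t. J (ga t) - J (gb t)) \<longlongrightarrow> 0) at_top"
  proof (rule tendsto_sandwich)
    show "\<forall>\<^sub>F t in at_top. J (ga t) - J (gb t) \<le> 0"
      using eventually_ge_at_top[of 0]
      by eventually_elim (use J_mono u_pos u_mono ab ga(1) gb(1) in simp)
    show "\<forall>\<^sub>F t in at_top. - (x * u t b * (clock b - clock a)) \<le> J (ga t) - J (gb t)"
      using eventually_ge_at_top[of 0]
    proof eventually_elim
      case (elim t)
      show ?case using J_le[OF u_pos[OF ab(1) elim] u_mono[OF ab elim]] ga(1) gb(1) elim ab b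
        by (simp add: clock_flow)
    qed
    have "((\<lambda>t. - (x * u t b * (clock b - clock a))) \<longlongrightarrow> - (x * 0 * (clock b - clock a))) at_top"
      by (intro tendsto_intros u_tendsto_zero b)
    then show "((\<lambda>t. - (x * u t b * (clock b - clock a))) \<longlongrightarrow> 0) at_top" by simp
  qed simp
  \<comment> \<open>the indicator makes the integrand measurable on the whole line; for negative times nothing is
    known about \<open>u\<close>\<close>
  have meas: "(\<lambda>t. indicator {0..} t *\<^sub>R (exp (- x * u t a) - exp (- x * u t b))) \<in> borel_measurable borel"
    by (intro borel_measurable_continuous_on_indicator continuous_intros u_continuous ab b) auto
  have "(\<integral>\<^sup>+t\<in>{0..}. ennreal (exp (- x * u t a) - exp (- x * u t b)) \<partial>lborel)
      = (\<integral>\<^sup>+t. ennreal (indicator {0..} t *\<^sub>R (exp (- x * u t a) - exp (- x * u t b))) * indicator {0..} t \<partial>lborel)"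
    by (intro nn_integral_cong) (auto split: split_indicator)
  also have "\<dots> = ennreal (0 - (J (ga 0) - J (gb 0)))"
  proof (rule nn_integral_FTC_atLeast[OF meas _ _ lim])
    fix t :: real assume t: "0 \<le> t"
    show "((\<lambda>t. J (ga t) - J (gb t)) has_real_derivative indicator {0..} t *\<^sub>R (exp (- x * u t a) - exp (- x * u t b))) (at t)"
      using DERIV_diff[OF dJ[OF ab(1) t ga(1)[OF t] ga(2)[OF t]] dJ[OF b t gb(1)[OF t] gb(2)[OF t]]] t by simp
    show "0 \<le> indicator {0..} t *\<^sub>R (exp (- x * u t a) - exp (- x * u t b))"
      using t u_mono[OF ab t] x by (auto intro: mult_left_mono)
  qed
  also have "\<dots> = ennreal (J b - J a)" using ga(1)[of 0] gb(1)[of 0] ab b by (simp add: u_zero)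
  also have "\<dots> = (\<integral>\<^sup>+l. ennreal (indicator {0<..} l *\<^sub>R ((1 - exp (- x * l)) * (1 / \<psi> l))) * indicator {a..b} l \<partial>lborel)"
    using ab x by (intro nn_integral_FTC_Icc[symmetric] borel_measurable_continuous_on_indicator cont)
      (auto intro!: J[THEN DERIV_cong] mult_nonneg_nonneg simp: psi_pos less_imp_le)
  also have "\<dots> = (\<integral>\<^sup>+l\<in>{a..b}. ennreal ((1 - exp (- x * l)) * (1 / \<psi> l)) \<partial>lborel)"
    using ab by (intro nn_integral_cong) (auto split: split_indicator)
  finally show ?thesis .
qed

end

section \<open>One-dimensional laws of the process\<close>

locale cb_scale = scale_flow \<psi> W u + cb_process \<psi> M P Z
  for \<psi> W :: "real \<Rightarrow> real" and u :: "real \<Rightarrow> real \<Rightarrow> real"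
    and M :: "'w measure" and P :: "real \<Rightarrow> 'w measure" and Z :: "real \<Rightarrow> 'w \<Rightarrow> real" +
  assumes laplace_Z: "\<And>x l t. 0 \<le> x \<Longrightarrow> 0 < l \<Longrightarrow> 0 \<le> t \<Longrightarrow>
    (\<integral>\<omega>. exp (- l * Z t \<omega>) \<partial>P x) = exp (- x * u t l)"
begin

lemma space_P: "0 \<le> x \<Longrightarrow> space (P x) = space M"
  using sets_P by (intro sets_eq_imp_space_eq)

lemma Z_measurable_P: "0 \<le> x \<Longrightarrow> 0 \<le> t \<Longrightarrow> Z t \<in> borel_measurable (P x)"
  using measurable_Z[of t] sets_P[of x] by (simp cong: measurable_cong_sets)

definition law :: "real \<Rightarrow> real \<Rightarrow> real measure" where
  "law t x = distr (P x) borel (Z t)"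

lemma sets_law[simp, measurable_cong]: "sets (law t x) = sets borel" and space_law[simp]: "space (law t x) = UNIV"
  by (auto simp: law_def)

lemma prob_space_law: "0 \<le> x \<Longrightarrow> 0 \<le> t \<Longrightarrow> prob_space (law t x)"
  unfolding law_def by (intro prob_space.prob_space_distr prob_space_P Z_measurable_P)

lemma law_nonneg: "0 \<le> x \<Longrightarrow> 0 \<le> t \<Longrightarrow> AE y in law t x. 0 \<le> y"
  unfolding law_def by (subst AE_distr_iff) (auto simp: Z_measurable_P space_P nonneg)

lemma emeasure_law:
  "0 \<le> x \<Longrightarrow> 0 \<le> t \<Longrightarrow> A \<in> sets borel \<Longrightarrow>
    emeasure (law t x) A = emeasure (P x) {\<omega> \<in> space (P x). Z t \<omega> \<in> A}"
  unfolding law_def by (subst emeasure_distr) (auto simp: Z_measurable_P vimage_def Int_def conj_commute)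

lemma nn_integral_law:
  "0 \<le> x \<Longrightarrow> 0 \<le> t \<Longrightarrow> f \<in> borel_measurable borel \<Longrightarrow>
    (\<integral>\<^sup>+y. f y \<partial>law t x) = (\<integral>\<^sup>+\<omega>. f (Z t \<omega>) \<partial>P x)"
  unfolding law_def by (subst nn_integral_distr) (auto simp: Z_measurable_P)

lemma law_laplace:
  assumes "0 \<le> x" "0 \<le> t" "0 < l"
  shows "integrable (law t x) (\<lambda>y. exp (- l * y))"
    and "(\<integral>y. exp (- l * y) \<partial>law t x) = exp (- x * u t l)"
proof -
  interpret prob_space "law t x" by (rule prob_space_law[OF assms(1,2)])
  show "integrable (law t x) (\<lambda>y. exp (- l * y))"
    using law_nonneg[OF assms(1,2)] assms(3)
    by (intro integrable_const_bound[of _ 1]) (auto elim!: eventually_mono)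
  show "(\<integral>y. exp (- l * y) \<partial>law t x) = exp (- x * u t l)"
    unfolding law_def using assms by (subst integral_distr) (auto simp: Z_measurable_P laplace_Z[simplified])
qed

lemma law_laplace_difference:
  assumes "0 \<le> x" "0 \<le> t" "0 < a" "a \<le> b"
  shows "(\<integral>\<^sup>+y. ennreal (exp (- a * y) - exp (- b * y)) \<partial>law t x)
       = ennreal (exp (- x * u t a) - exp (- x * u t b))"
proof -
  have b: "0 < b" using assms by simp
  note A = law_laplace[OF assms(1-3)] and B = law_laplace[OF assms(1,2) b]
  have "AE y in law t x. 0 \<le> exp (- a * y) - exp (- b * y)"
    using law_nonneg[OF assms(1,2)] assms(4) by (auto elim!: eventually_mono intro: mult_right_mono)
  from nn_integral_eq_integral[OF Bochner_Integration.integrable_diff[OF A(1) B(1)] this]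
  show ?thesis using A B by simp
qed

lemma law_zero:
  assumes x: "0 \<le> x" and t: "0 < t"
  shows "measure (law t x) {0} = exp (- x * v t)"
proof -
  have t': "0 \<le> t" using t by simp
  interpret prob_space "law t x" by (rule prob_space_law[OF x t'])
  have "(\<lambda>n. \<integral>y. exp (- real (Suc n) * y) \<partial>law t x) \<longlonglongrightarrow> (\<integral>y. indicator {0} y \<partial>law t x)"
  proof (rule integral_dominated_convergence[where w="\<lambda>_. 1"])
    show "AE y in law t x. (\<lambda>n. exp (- real (Suc n) * y)) \<longlonglongrightarrow> indicator {0} y"
      using law_nonneg[OF x t']
    proof eventually_elim
      case (elim y)
      show ?case using exp_neg_Suc_mult_tendsto_zero[of y] elim by (cases "y = 0") auto
    qed
    show "AE y in law t x. norm (exp (- real (Suc n) * y)) \<le> 1" for n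
      using law_nonneg[OF x t'] by (auto elim!: eventually_mono simp: mult_nonpos_nonneg)
  qed auto
  moreover have "(\<lambda>n. \<integral>y. exp (- real (Suc n) * y) \<partial>law t x) = (\<lambda>n. exp (- x * u t (real (Suc n))))"
    using x t by (intro ext law_laplace(2)) auto
  moreover have "(\<lambda>n. exp (- x * u t (real (Suc n)))) \<longlonglongrightarrow> exp (- x * v t)"
    by (intro tendsto_intros filterlim_compose[OF u_tendsto_v[OF t]]
        filterlim_compose[OF filterlim_real_sequentially filterlim_Suc])
  ultimately show ?thesis using LIMSEQ_unique by (simp del: of_nat_Suc) blast
qed

text \<open>
  The branching property: the transforms \<open>exp (- x * u t l)\<close> and \<open>exp (- y * u t l)\<close> multiply.
\<close>

lemma law_convolution:
  assumes x: "0 \<le> x" "0 \<le> y" and t: "0 \<le> t"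
  shows "law t x \<star> law t y = law t (x + y)"
proof -
  interpret X: prob_space "law t x" by (rule prob_space_law[OF x(1) t])
  interpret Y: prob_space "law t y" by (rule prob_space_law[OF x(2) t])
  interpret XY: prob_space "law t (x + y)" by (rule prob_space_law[OF add_nonneg_nonneg[OF x] t])
  note conv = nn_integral_convolution[OF X.finite_measure_axioms Y.finite_measure_axioms sets_law sets_law]
  have nn_laplace: "(\<integral>\<^sup>+y. ennreal (exp (- l * y)) \<partial>law t z) = ennreal (exp (- z * u t l))"
    if "0 \<le> z" "0 < l" for z l
    using nn_integral_eq_integral[OF law_laplace(1)[OF that(1) t that(2)]] law_laplace(2)[OF that(1) t that(2)] by simp
  have pos: "AE p in law t x. AE q in law t y. 0 \<le> p + q"
    using law_nonneg[OF x(1) t]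
  proof eventually_elim
    case (elim p)
    show ?case using law_nonneg[OF x(2) t] by eventually_elim (use elim in simp)
  qed
  have eq: "(\<integral>\<^sup>+z. ennreal (exp (- real n * z)) \<partial>(law t x \<star> law t y))
      = (\<integral>\<^sup>+z. ennreal (exp (- real n * z)) \<partial>law t (x + y))" for n
  proof (cases "n = 0")
    case True
    have "emeasure (law t x \<star> law t y) UNIV = 1"
      using conv[of "\<lambda>_. 1"] X.emeasure_space_1 Y.emeasure_space_1 by simp
    then show ?thesis using True XY.emeasure_space_1 by simp
  next
    case False
    have "(\<integral>\<^sup>+z. ennreal (exp (- real n * z)) \<partial>(law t x \<star> law t y))
      = (\<integral>\<^sup>+p. ennreal (exp (- real n * p)) * (\<integral>\<^sup>+q. ennreal (exp (- real n * q)) \<partial>law t y) \<partial>law t x)"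
      by (subst conv, simp, subst nn_integral_cmult[symmetric])
        (auto simp: ennreal_mult[symmetric] exp_add[symmetric] algebra_simps)
    also have "\<dots> = ennreal (exp (- x * u t n)) * ennreal (exp (- y * u t n))"
      using False x by (simp only: nn_laplace of_nat_0_less_iff nn_integral_multc) (simp add: nn_integral_multc nn_laplace[simplified])
    also have "\<dots> = ennreal (exp (- (x + y) * u t n))"
      by (simp add: ennreal_mult[symmetric] exp_add[symmetric] algebra_simps)
    also have "\<dots> = (\<integral>\<^sup>+z. ennreal (exp (- real n * z)) \<partial>law t (x + y))"
      using False x by (intro nn_laplace[symmetric]) auto
    finally show ?thesis .
  qed
  show ?thesis
  proof (rule measure_eqI_weighted_laplace[where S=UNIV and w="\<lambda>_. 1"])
    have "(\<integral>\<^sup>+z. indicator {..<0} z \<partial>(law t x \<star> law t y)) = (\<integral>\<^sup>+p. \<integral>\<^sup>+q. indicator {..<0} (p + q) \<partial>law t y \<partial>law t x)"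
      by (rule conv) simp
    also have "\<dots> = (\<integral>\<^sup>+p. 0 \<partial>law t x)"
    proof (rule nn_integral_cong_AE, use pos in eventually_elim)
      case (elim p)
      have "(\<integral>\<^sup>+q. indicator {..<0} (p + q) \<partial>law t y) = (\<integral>\<^sup>+q. 0 \<partial>law t y)"
        by (rule nn_integral_cong_AE, use elim in eventually_elim) auto
      then show ?case by simp
    qed
    finally have "emeasure (law t x \<star> law t y) {..<0} = 0" by (subst (asm) nn_integral_indicator) auto
    then show "AE z in law t x \<star> law t y. 0 \<le> z"
      by (intro AE_I[of _ _ "{..<0}"]) auto
    show "AE z in law t (x + y). 0 \<le> z" by (rule law_nonneg[OF add_nonneg_nonneg[OF x] t])
    show "(\<integral>\<^sup>+z. ennreal 1 \<partial>(law t x \<star> law t y)) < \<infinity>"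
      by (simp add: conv[of "\<lambda>_. 1", simplified] X.emeasure_space_1[simplified] Y.emeasure_space_1[simplified])
  qed (use eq in auto)
qed

text \<open>
  Populations started from \<open>x\<close> and \<open>y\<close> evolve independently: let the first one end in \<open>A\<close> and the
  second one die out.
\<close>

lemma law_add_ge:
  assumes x: "0 \<le> x" "0 \<le> y" and t: "0 \<le> t" and A[measurable]: "A \<in> sets borel"
  shows "emeasure (law t x) A * emeasure (law t y) {0} \<le> emeasure (law t (x + y)) A"
proof -
  interpret X: prob_space "law t x" by (rule prob_space_law[OF x(1) t])
  interpret Y: prob_space "law t y" by (rule prob_space_law[OF x(2) t])
  have "emeasure (law t x) A * emeasure (law t y) {0}
      = (\<integral>\<^sup>+p. \<integral>\<^sup>+q. indicator A p * indicator {0} q \<partial>law t y \<partial>law t x)"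
    by (simp add: nn_integral_cmult nn_integral_multc)
  also have "\<dots> \<le> (\<integral>\<^sup>+p. \<integral>\<^sup>+q. indicator A (p + q) \<partial>law t y \<partial>law t x)"
    by (intro nn_integral_mono) (auto split: split_indicator)
  also have "\<dots> = emeasure (law t x \<star> law t y) A"
    by (rule convolution_emeasure'[symmetric]) (auto simp: X.finite_measure_axioms Y.finite_measure_axioms)
  finally show ?thesis by (simp only: law_convolution[OF x t])
qed

text \<open>
  The process is alive at time \<open>t\<close> with probability about \<open>x * v t\<close> for small \<open>x\<close>, and the probability
  of being alive outside a large compact interval of \<open>(0, \<infinity>)\<close> is at most a small multiple of \<open>x\<close>.
\<close>

lemma law_window_near_zero:
  assumes t: "0 < t"
  obtains a b where "0 < a" "\<And>x. 0 < x \<Longrightarrow> x * v t \<le> 1 \<Longrightarrow> x * v t / 4 \<le> measure (law t x) {a..b}"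
proof -
  define V where "V = v t"
  have V: "0 < V" using v_pos[OF t] by (simp add: V_def)
  \<comment> \<open>24 and 16 are chosen to make each of the two error terms below at most \<open>x * V / 8\<close>\<close>
  have "\<forall>\<^sub>F l in at_top. V - V / 24 < u t l \<and> 0 < l"
    using V order_tendstoD(1)[OF u_tendsto_v[OF t], of "V - V / 24"] eventually_gt_at_top[of 0]
    by (auto intro: eventually_conj simp: V_def)
  then obtain k where k: "V - V / 24 < u t k" "0 < k"
    using eventually_happens'[OF trivial_limit_at_top_linorder] by blast
  define j where "j = V / 16"
  have j: "0 < j" using V by (simp add: j_def)
  show ?thesis
  proof (rule that[of "1 / k" "1 / j"])
    show "0 < 1 / k" using k by simp
    fix x :: real assume x: "0 < x" "x * v t \<le> 1"
    have x0: "0 \<le> x" and t0: "0 \<le> t" using x t by auto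
    interpret prob_space "law t x" by (rule prob_space_law[OF x0 t0])
    have e1: "2 \<le> exp (1::real)" "exp 1 \<le> (3::real)"
      using exp_ge_add_one_self[of 1] exp_le by auto
    \<comment> \<open>\<open>2 * (1 - exp (- j * y))\<close> exceeds 1 to the right of \<open>1 / j\<close>, and \<open>3 * exp (- k * y)\<close> exceeds 1 to
      the left of \<open>1 / k\<close>; both have explicit expectations\<close>
    have pw: "1 - indicator {0} y - 2 * (1 - exp (- j * y)) - 3 * (exp (- k * y) - indicator {0} y)
        \<le> indicator {1 / k..1 / j} y" if y: "0 \<le> y" for y :: real
    proof (cases "y = 0")
      case False
      define p q where "p = exp (- k * y)" and "q = exp (- j * y)"
      have "q \<le> 1" "0 < p" using y j by (auto simp: p_def q_def)
      moreover have "1 / 3 \<le> p" if "y < 1 / k"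
      proof -
        have "1 / 3 \<le> exp (- 1 :: real)" using e1 by (simp add: exp_minus field_simps)
        also have "\<dots> \<le> p" using that k by (simp add: p_def field_simps)
        finally show ?thesis .
      qed
      moreover have "q \<le> 1 / 2" if "1 / j < y"
      proof -
        have "q \<le> exp (- 1)" using that j by (simp add: q_def field_simps)
        also have "\<dots> \<le> 1 / 2" using e1 by (simp add: exp_minus field_simps)
        finally show ?thesis .
      qed
      ultimately show ?thesis
        using False unfolding p_def[symmetric] q_def[symmetric]
        by (cases "y < 1 / k"; cases "1 / j < y") (auto simp: not_le not_less)
    qed (auto split: split_indicator)
    note L = law_laplace[OF x0 t0]
    have hb: "has_bochner_integral (law t x) (\<lambda>_. 1) (1::real)"
      "has_bochner_integral (law t x) (indicator {0}) (exp (- x * V))"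
      "has_bochner_integral (law t x) (\<lambda>y. exp (- j * y)) (exp (- x * u t j))"
      "has_bochner_integral (law t x) (\<lambda>y. exp (- k * y)) (exp (- x * u t k))"
      using L[OF j] L[OF k(2)] law_zero[OF x0 t] prob_space
      by (auto simp: has_bochner_integral_iff V_def emeasure_eq_measure intro!: integrable_real_indicator)
    have total: "has_bochner_integral (law t x)
        (\<lambda>y. 1 - indicator {0} y - 2 * (1 - exp (- j * y)) - 3 * (exp (- k * y) - indicator {0} y))
        (1 - exp (- x * V) - 2 * (1 - exp (- x * u t j)) - 3 * (exp (- x * u t k) - exp (- x * V)))"
      by (intro has_bochner_integral_diff has_bochner_integral_mult_right hb)
    note int = integrable.intros[OF total]
    have "(\<integral>y. 1 - indicator {0} y - 2 * (1 - exp (- j * y)) - 3 * (exp (- k * y) - indicator {0} y) \<partial>law t x)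
        \<le> (\<integral>y. indicator {1 / k..1 / j} y \<partial>law t x)"
      by (rule integral_mono_AE[OF int]) (use law_nonneg[OF x0 t0] pw in
          \<open>auto elim!: eventually_mono intro!: integrable_real_indicator simp: emeasure_eq_measure\<close>)
    also have "(\<integral>y. 1 - indicator {0} y - 2 * (1 - exp (- j * y)) - 3 * (exp (- k * y) - indicator {0} y) \<partial>law t x)
      = 1 - exp (- x * V) - 2 * (1 - exp (- x * u t j)) - 3 * (exp (- x * u t k) - exp (- x * V))"
      by (rule has_bochner_integral_integral_eq[OF total])
    finally have main: "1 - exp (- x * V) - 2 * (1 - exp (- x * u t j)) - 3 * (exp (- x * u t k) - exp (- x * V))
      \<le> measure (law t x) {1 / k..1 / j}" by simp
    have "A / 4 \<le> 1 - E - 2 * (1 - U) - 3 * (K - E)"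
      if "A / 2 \<le> 1 - E" "1 - U \<le> A / 16" "K - E \<le> A / 24" for A E U K :: real
      using that by (simp add: field_simps)
    moreover have "x * V / 2 \<le> 1 - exp (- x * V)"
      using exp_neg_le_linear[of "x * V"] x V by (simp add: V_def)
    moreover have "1 - exp (- x * u t j) \<le> x * V / 16"
    proof -
      have "1 - exp (- x * u t j) \<le> x * u t j" using exp_ge_add_one_self[of "- x * u t j"] by simp
      also have "\<dots> \<le> x * j" using u_le[OF j t0] x by simp
      finally show ?thesis by (simp add: j_def)
    qed
    moreover have "exp (- x * u t k) - exp (- x * V) \<le> x * V / 24"
    proof -
      have "exp (- (x * u t k)) - exp (- (x * V)) \<le> x * V - x * u t k"
        using x u_le_v[OF t k(2)] u_pos[OF k(2) t0] by (intro exp_neg_diff_le) (auto simp: V_def)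
      also have "\<dots> = x * (V - u t k)" by (simp add: algebra_simps)
      also have "\<dots> \<le> x * (V / 24)" using x k by (intro mult_left_mono) auto
      finally show ?thesis by simp
    qed
    ultimately have "x * V / 4 \<le> 1 - exp (- x * V) - 2 * (1 - exp (- x * u t j)) - 3 * (exp (- x * u t k) - exp (- x * V))"
      by blast
    with main show "x * v t / 4 \<le> measure (law t x) {1 / k..1 / j}" by (simp add: V_def)
  qed
qed

text \<open>
  One compact interval catches \<open>Z t\<close> with sufficient probability for all starting points: beyond
  \<open>1 / v t\<close>, let mass \<open>1 / v t\<close> end in the interval and the remaining mass die out.
\<close>

lemma law_window:
  assumes t: "0 < t"
  obtains a b where "0 < a" "\<And>x. 0 < x \<Longrightarrow>
    ennreal (1 / 4 * min 1 (x * v t) * exp (- x * v t)) \<le> emeasure (law t x) {a..b}"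
proof -
  obtain a b where a: "0 < a"
    and near: "\<And>x. 0 < x \<Longrightarrow> x * v t \<le> 1 \<Longrightarrow> x * v t / 4 \<le> measure (law t x) {a..b}"
    using law_window_near_zero[OF t] by blast
  have V: "0 < v t" by (rule v_pos[OF t])
  show ?thesis
  proof (rule that[OF a])
    fix x :: real assume x: "0 < x"
    show "ennreal (1 / 4 * min 1 (x * v t) * exp (- x * v t)) \<le> emeasure (law t x) {a..b}"
    proof (cases "x * v t \<le> 1")
      case True
      interpret prob_space "law t x" using x t by (intro prob_space_law) auto
      have "1 / 4 * min 1 (x * v t) * exp (- x * v t) \<le> x * v t / 4 * 1"
        using True x V by (intro mult_mono) auto
      also have "\<dots> \<le> measure (law t x) {a..b}" using near[OF x True] by simp
      finally show ?thesis by (simp add: emeasure_eq_measure ennreal_leI)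
    next
      case False
      define x0 where "x0 = 1 / v t"
      have x0: "0 < x0" "x0 * v t = 1" "x0 \<le> x" using V False by (auto simp: x0_def field_simps)
      interpret X0: prob_space "law t x0" using x0 t by (intro prob_space_law) auto
      interpret D: prob_space "law t (x - x0)" using x0 t by (intro prob_space_law) auto
      have "1 / 4 * min 1 (x * v t) * exp (- x * v t) \<le> 1 / 4 * exp (- (x - x0) * v t)"
        using False x0 V by (simp add: algebra_simps)
      also have "\<dots> \<le> measure (law t x0) {a..b} * exp (- (x - x0) * v t)"
        using near[OF x0(1)] x0(2) by (intro mult_right_mono) auto
      finally have "ennreal (1 / 4 * min 1 (x * v t) * exp (- x * v t))
          \<le> emeasure (law t x0) {a..b} * emeasure (law t (x - x0)) {0}"
        using law_zero[of "x - x0" t] x0 t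
        by (simp add: X0.emeasure_eq_measure D.emeasure_eq_measure ennreal_mult[symmetric] ennreal_leI)
      also have "\<dots> \<le> emeasure (law t (x0 + (x - x0))) {a..b}"
        using x0 t by (intro law_add_ge) auto
      finally show ?thesis by simp
    qed
  qed
qed

end

section \<open>The potential density\<close>

context cb_scale begin

text \<open>
  By right continuity \<open>Z\<close> is the limit of its values at the next point of a grid of mesh \<open>1 / (n + 1)\<close>.
  The clipping \<open>max 0 t\<close> defines the process for all real times.
\<close>

lemma Z_jointly_measurable: "(\<lambda>(t, \<omega>). Z (max 0 t) \<omega>) \<in> borel_measurable (borel \<Otimes>\<^sub>M M)"
proof (rule borel_measurable_LIMSEQ_real)
  \<comment> \<open>the grid point \<open>r n t\<close> lies strictly to the right of \<open>max 0 t\<close>, as a limit from the right requires\<close>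
  define k where "k n t = nat \<lfloor>real (Suc n) * t\<rfloor>" for n t
  define r where "r n t = (real (k n t) + 1) / real (Suc n)" for n t
  show "(\<lambda>p. Z (r n (fst p)) (snd p)) \<in> borel_measurable (borel \<Otimes>\<^sub>M M)" for n
  proof -
    have "(\<lambda>p. (\<lambda>i p. Z ((real i + 1) / real (Suc n)) (snd p)) (k n (fst p)) p) \<in> borel_measurable (borel \<Otimes>\<^sub>M M)"
    proof (rule measurable_compose_countable[where g="\<lambda>p. k n (fst p)"])
      show "(\<lambda>p. Z ((real i + 1) / real (Suc n)) (snd p)) \<in> borel_measurable (borel \<Otimes>\<^sub>M M)" for i
        by (rule measurable_compose[OF measurable_snd measurable_Z]) simp
      show "(\<lambda>p. k n (fst p)) \<in> (borel \<Otimes>\<^sub>M M) \<rightarrow>\<^sub>M count_space UNIV"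
        unfolding k_def by measurable
    qed
    then show ?thesis by (simp add: r_def)
  qed
  fix p assume "p \<in> space (borel \<Otimes>\<^sub>M M :: (real \<times> 'w) measure)"
  then obtain t \<omega> where p: "p = (t, \<omega>)" "\<omega> \<in> space M" by (auto simp: space_pair_measure)
  have bounds: "max 0 t < r n t \<and> r n t \<le> max 0 t + inverse (real (Suc n))" for n
  proof -
    have "real (k n t) = of_int (max 0 \<lfloor>real (Suc n) * t\<rfloor>)" by (simp add: k_def max_def)
    moreover have "of_int \<lfloor>real (Suc n) * t\<rfloor> \<le> real (Suc n) * t"
      "real (Suc n) * t < of_int \<lfloor>real (Suc n) * t\<rfloor> + 1" by linarith+
    ultimately have "real (Suc n) * max 0 t < real (k n t) + 1" "real (k n t) \<le> real (Suc n) * max 0 t"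
      by (auto simp: max_def mult_less_0_iff zero_le_mult_iff split: if_splits)
    moreover have "m < (j + 1) / s \<and> j / s \<le> m" if "s * m < j + 1" "j \<le> s * m" "0 < s" for m j s :: real
      using that by (simp add: field_simps)
    ultimately have "max 0 t < r n t \<and> real (k n t) / real (Suc n) \<le> max 0 t"
      unfolding r_def by (meson of_nat_0_less_iff zero_less_Suc)
    then show ?thesis unfolding r_def add_divide_distrib by (simp add: inverse_eq_divide)
  qed
  have "(\<lambda>n. r n t) \<longlonglongrightarrow> max 0 t"
  proof (rule tendsto_sandwich[where f="\<lambda>_. max 0 t"])
    show "(\<lambda>n. max 0 t + inverse (real (Suc n))) \<longlonglongrightarrow> max 0 t"
      using tendsto_add[OF tendsto_const LIMSEQ_inverse_real_of_nat] by simp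
    show "\<forall>\<^sub>F n in sequentially. max 0 t \<le> r n t" "\<forall>\<^sub>F n in sequentially. r n t \<le> max 0 t + inverse (real (Suc n))"
      using bounds by (auto intro!: always_eventually less_imp_le simp del: of_nat_Suc max.bounded_iff max_less_iff_conj)
  qed simp
  moreover have "r n t \<noteq> max 0 t" for n using bounds[of n] by force
  ultimately have "filterlim (\<lambda>n. r n t) (at_right (max 0 t)) sequentially"
    using bounds unfolding filterlim_at by (auto intro!: always_eventually)
  moreover have "((\<lambda>s. Z s \<omega>) \<longlongrightarrow> Z (max 0 t) \<omega>) (at_right (max 0 t))"
    using right_continuous[of "max 0 t" \<omega>] p(2) by (simp add: continuous_within)
  ultimately show "(\<lambda>n. Z (r n (fst p)) (snd p)) \<longlonglongrightarrow> (case p of (t, \<omega>) \<Rightarrow> Z (max 0 t) \<omega>)"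
    using filterlim_compose[of "\<lambda>s. Z s \<omega>"] by (fastforce simp: p)
qed

text \<open>
  The image of Lebesgue measure times \<open>P x\<close>, a measure by construction. That the set function
  defining the potential measure is countably additive follows by comparing values.
\<close>

definition occupation :: "real \<Rightarrow> real measure" where
  "occupation x = restrict_space
     (distr (restrict_space lborel {0..} \<Otimes>\<^sub>M P x) borel (\<lambda>(t, \<omega>). Z (max 0 t) \<omega>)) {0<..}"

lemma sets_occupation: "sets (occupation x) = sets (restrict_space borel {0<..})"
  by (simp add: occupation_def sets_restrict_space)

lemma nn_integral_occupation:
  assumes x: "0 \<le> x" and [measurable]: "f \<in> borel_measurable borel"
  shows "(\<integral>\<^sup>+y. f y \<partial>occupation x) = (\<integral>\<^sup>+t\<in>{0..}. (\<integral>\<^sup>+y\<in>{0<..}. f y \<partial>law t x) \<partial>lborel)"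
proof -
  interpret prob_space "P x" by (rule prob_space_P[OF x])
  have meas[measurable]: "(\<lambda>(t, \<omega>). Z (max 0 t) \<omega>) \<in> borel_measurable (restrict_space lborel {0..} \<Otimes>\<^sub>M P x)"
  proof -
    have "(\<lambda>p. p) \<in> restrict_space lborel {0..} \<Otimes>\<^sub>M P x \<rightarrow>\<^sub>M borel \<Otimes>\<^sub>M M"
    proof (rule measurable_pair)
      have "fst \<in> restrict_space lborel {0..} \<Otimes>\<^sub>M P x \<rightarrow>\<^sub>M borel"
        by (rule measurable_compose[OF measurable_fst]) (auto intro: measurable_restrict_space1)
      then show "fst \<circ> (\<lambda>p. p) \<in> restrict_space lborel {0..} \<Otimes>\<^sub>M P x \<rightarrow>\<^sub>M borel" by (simp add: comp_def)
      have "snd \<in> restrict_space lborel {0..} \<Otimes>\<^sub>M P x \<rightarrow>\<^sub>M P x" by (rule measurable_snd)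
      then show "snd \<circ> (\<lambda>p. p) \<in> restrict_space lborel {0..} \<Otimes>\<^sub>M P x \<rightarrow>\<^sub>M M"
        using sets_P[OF x] by (simp add: comp_def cong: measurable_cong_sets)
    qed
    from measurable_compose[OF this Z_jointly_measurable] show ?thesis .
  qed
  have "(\<integral>\<^sup>+y. f y \<partial>occupation x) = (\<integral>\<^sup>+p. (\<lambda>y. f y * indicator {0<..} y) (case p of (t, \<omega>) \<Rightarrow> Z (max 0 t) \<omega>)
        \<partial>(restrict_space lborel {0..} \<Otimes>\<^sub>M P x))"
      unfolding occupation_def by (subst nn_integral_restrict_space, simp, subst nn_integral_distr) (auto simp: meas)
    also have "\<dots> = (\<integral>\<^sup>+t. \<integral>\<^sup>+\<omega>. f (Z (max 0 t) \<omega>) * indicator {0<..} (Z (max 0 t) \<omega>) \<partial>P x \<partial>restrict_space lborel {0..})"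
      by (subst nn_integral_fst[symmetric]) (auto intro!: measurable_compose[OF meas] simp: split_beta')
    also have "\<dots> = (\<integral>\<^sup>+t\<in>{0..}. (\<integral>\<^sup>+y\<in>{0<..}. f y \<partial>law t x) \<partial>lborel)"
      by (subst nn_integral_restrict_space, simp, intro nn_integral_cong)
        (auto split: split_indicator simp: nn_integral_law x)
    finally show ?thesis .
qed

lemma potential_measure_eq_occupation:
  assumes x: "0 \<le> x" shows "potential_measure P Z x = occupation x"
proof -
  note sets = sets_occupation[of x]
  have "occupation x = measure_of {0<..} (sets (restrict_space borel {0<..})) (emeasure (occupation x))"
    using measure_of_of_measure[of "occupation x"] sets sets_eq_imp_space_eq[OF sets] by (simp add: space_restrict_space)
  also have "\<dots> = potential_measure P Z x"
    unfolding potential_measure_def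
  proof (rule measure_of_eq)
    show "sets (restrict_space borel {0<..}) \<subseteq> Pow {0<..}" by (auto simp: sets_restrict_space)
    fix A :: "real set" assume "A \<in> sigma_sets {0<..} (sets (restrict_space borel {0<..}))"
    then have A: "A \<in> sets (restrict_space borel {0<..})"
      using sets.sigma_sets_eq[of "restrict_space borel {0::real<..}"] by (simp add: space_restrict_space)
    then have A': "A \<in> sets borel" "A \<subseteq> {0<..}" by (auto simp: sets_restrict_space_iff)
    have "emeasure (occupation x) A = (\<integral>\<^sup>+y. indicator A y \<partial>occupation x)" using A sets by simp
    also have "\<dots> = (\<integral>\<^sup>+t\<in>{0..}. (\<integral>\<^sup>+y\<in>{0<..}. indicator A y \<partial>law t x) \<partial>lborel)"
      using A' by (intro nn_integral_occupation x) auto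
    also have "\<dots> = (\<integral>\<^sup>+t\<in>{0..}. emeasure (P x) {\<omega> \<in> space (P x). Z t \<omega> \<in> A} \<partial>lborel)"
    proof (intro nn_integral_cong)
      fix t
      have "(\<integral>\<^sup>+y\<in>{0<..}. indicator A y \<partial>law t x) = (\<integral>\<^sup>+y. indicator A y \<partial>law t x)"
        using A' by (intro nn_integral_cong) (auto split: split_indicator)
      then show "(\<integral>\<^sup>+y\<in>{0<..}. indicator A y \<partial>law t x) * indicator {0..} t
        = emeasure (P x) {\<omega> \<in> space (P x). Z t \<omega> \<in> A} * indicator {0..} t"
        using A' x by (auto simp: emeasure_law split: split_indicator)
    qed
    finally show "emeasure (occupation x) A = (\<integral>\<^sup>+t\<in>{0..}. emeasure (P x) {\<omega> \<in> space (P x). Z t \<omega> \<in> A} \<partial>lborel)" .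
  qed
  finally show "potential_measure P Z x = occupation x" by simp
qed

text \<open>
  As \<open>W\<close> vanishes on the negative half-line, shifting it by \<open>x\<close> multiplies its transform by
  \<open>exp (- x * l)\<close>.
\<close>

lemma scale_increment_laplace:
  assumes x: "0 \<le> x" and l: "0 < l"
  shows "(\<integral>\<^sup>+y\<in>{0<..}. ennreal (exp (- l * y) * (W y - W (y - x))) \<partial>lborel)
       = ennreal ((1 - exp (- x * l)) * (1 / \<psi> l))"
proof -
  let ?f = "\<lambda>y. exp (- l * y) * W y"
  have shift: "exp (- l * y) * W (y - x) = exp (- x * l) * ?f (- x + 1 * y)" for y
    by (simp add: exp_add[symmetric] algebra_simps)
  have i1: "integrable lborel (\<lambda>y. exp (- l * y) * W (y - x))"
    unfolding shift using lborel_integrable_real_affine[OF W_laplace(1)[OF l], of 1 "- x"] by simp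
  have i2: "(\<integral>y. exp (- l * y) * W (y - x) \<partial>lborel) = exp (- x * l) * (1 / \<psi> l)"
    unfolding shift using lborel_integral_real_affine[of 1 ?f "- x"] W_laplace(2)[OF l] by simp
  have "(\<integral>\<^sup>+y\<in>{0<..}. ennreal (exp (- l * y) * (W y - W (y - x))) \<partial>lborel)
      = (\<integral>\<^sup>+y. ennreal (?f y - exp (- l * y) * W (y - x)) \<partial>lborel)"
    using x by (intro nn_integral_cong_AE, use AE_lborel_singleton[of 0] in eventually_elim)
      (auto split: split_indicator simp: W_neg right_diff_distrib)
  also have "\<dots> = ennreal (\<integral>y. ?f y - exp (- l * y) * W (y - x) \<partial>lborel)"
    using W_laplace(1)[OF l] i1 x by (intro nn_integral_eq_integral) (auto simp: W_mono)
  also have "\<dots> = ennreal ((1 - exp (- x * l)) * (1 / \<psi> l))"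
    using W_laplace[OF l] i1 i2 by (simp add: left_diff_distrib diff_divide_distrib)
  finally show ?thesis .
qed

text \<open>
  For both measures the integral of \<open>exp (- a * y) - exp (- b * y)\<close> is the integral of
  \<open>(1 - exp (- x * l)) / \<psi> l\<close> from \<open>a\<close> to \<open>b\<close>.
\<close>

lemma potential_density:
  assumes x: "0 \<le> x"
  shows "potential_measure P Z x =
    density (restrict_space lborel {0<..}) (\<lambda>y. ennreal ((W y - W (y - x)) / y))" (is "_ = ?H")
proof (rule measure_eqI_laplace_difference)
  show "sets (potential_measure P Z x) = sets (restrict_space borel {0<..})"
    by (simp add: potential_measure_eq_occupation[OF x] sets_occupation)
  show "sets ?H = sets (restrict_space borel {0<..})" by (simp add: sets_restrict_space)
  fix a b :: real assume ab: "0 < a" "a \<le> b"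
  let ?e = "\<lambda>y. ennreal (exp (- a * y) - exp (- b * y))"
  let ?J = "\<integral>\<^sup>+l\<in>{a..b}. ennreal ((1 - exp (- x * l)) * (1 / \<psi> l)) \<partial>lborel"
  have "(\<integral>\<^sup>+y. ?e y \<partial>potential_measure P Z x) = (\<integral>\<^sup>+t\<in>{0..}. (\<integral>\<^sup>+y\<in>{0<..}. ?e y \<partial>law t x) \<partial>lborel)"
    unfolding potential_measure_eq_occupation[OF x] by (rule nn_integral_occupation[OF x]) simp
  also have "\<dots> = (\<integral>\<^sup>+t\<in>{0..}. ennreal (exp (- x * u t a) - exp (- x * u t b)) \<partial>lborel)"
  proof (intro nn_integral_cong)
    fix t
    have "(\<integral>\<^sup>+y\<in>{0<..}. ?e y \<partial>law t x) = (\<integral>\<^sup>+y. ?e y \<partial>law t x)" if "0 \<le> t"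
      using law_nonneg[OF x that]
      by (intro nn_integral_cong_AE) (auto elim!: eventually_mono split: split_indicator)
    then show "(\<integral>\<^sup>+y\<in>{0<..}. ?e y \<partial>law t x) * indicator {0..} t
      = ennreal (exp (- x * u t a) - exp (- x * u t b)) * indicator {0..} t"
      using law_laplace_difference[OF x _ ab] by (auto split: split_indicator)
  qed
  also have "\<dots> = ?J" by (rule nn_integral_time_flow_difference[OF ab x])
  finally have G: "(\<integral>\<^sup>+y. ?e y \<partial>potential_measure P Z x) = ?J" .
  have "(\<integral>\<^sup>+y. ?e y \<partial>?H) = (\<integral>\<^sup>+y\<in>{0<..}. ennreal ((W y - W (y - x)) / y) * ?e y \<partial>lborel)"
    by (subst nn_integral_density) (auto intro!: measurable_restrict_space1 simp: nn_integral_restrict_space)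
  also have "\<dots> = (\<integral>\<^sup>+y\<in>{0<..}. ennreal ((exp (- a * y) - exp (- b * y)) * ((W y - W (y - x)) / y)) \<partial>lborel)"
    using x W_mono ab by (intro nn_integral_cong) (auto split: split_indicator simp: ennreal_mult'[symmetric] mult.commute)
  also have "\<dots> = (\<integral>\<^sup>+l\<in>{a..b}. (\<integral>\<^sup>+y\<in>{0<..}. ennreal (exp (- l * y) * (W y - W (y - x))) \<partial>lborel) \<partial>lborel)"
    using ab x W_mono by (intro nn_integral_Laplace_difference) auto
  also have "\<dots> = ?J"
  proof (intro nn_integral_cong)
    fix l
    show "(\<integral>\<^sup>+y\<in>{0<..}. ennreal (exp (- l * y) * (W y - W (y - x))) \<partial>lborel) * indicator {a..b} l
      = ennreal ((1 - exp (- x * l)) * (1 / \<psi> l)) * indicator {a..b} l"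
      using scale_increment_laplace[OF x, of l] ab by (cases "l \<in> {a..b}") auto
  qed
  finally show "(\<integral>\<^sup>+y. ?e y \<partial>potential_measure P Z x) = (\<integral>\<^sup>+y. ?e y \<partial>?H)" using G by simp
  have "?J \<le> (\<integral>\<^sup>+l. ennreal (1 / \<psi> l * indicator {0<..} l) * indicator {a..b} l \<partial>lborel)"
    using ab x by (intro nn_integral_mono) (auto split: split_indicator intro!: ennreal_leI mult_left_le_one_le
        simp: psi_pos less_imp_le mult_nonneg_nonpos divide_right_mono)
  also have "\<dots> = ennreal (clock b - clock a)"
    using ab by (intro nn_integral_FTC_Icc inverse_psi_measurable) (auto simp: clock_deriv psi_pos less_imp_le)
  finally show "(\<integral>\<^sup>+y. ?e y \<partial>potential_measure P Z x) < \<infinity>" using G by (simp add: le_less_trans)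
qed

end

section \<open>Existence and uniqueness of the stationary measure\<close>

context cb_scale begin

lemma law_kernel:
  assumes nu: "sets \<nu> = sets (restrict_space borel {0<..})" and t: "0 \<le> t"
  shows "law t \<in> \<nu> \<rightarrow>\<^sub>M subprob_algebra borel"
proof (rule measurable_subprob_algebra)
  have sp: "space \<nu> = {0<..}" using sets_eq_imp_space_eq[OF nu] by (simp add: space_restrict_space)
  show "subprob_space (law t x)" if "x \<in> space \<nu>" for x
    using that t by (intro prob_space_imp_subprob_space prob_space_law) (auto simp: sp)
  show "sets (law t x) = sets borel" for x by simp
  show "(\<lambda>x. emeasure (law t x) A) \<in> borel_measurable \<nu>" if A: "A \<in> sets borel" for A
  proof -
    have "(\<lambda>x. x) \<in> \<nu> \<rightarrow>\<^sub>M restrict_space borel {0::real..}"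
      using nu by (intro measurable_restrict_space2)
        (auto simp: sp cong: measurable_cong_sets intro!: measurable_restrict_space1)
    from measurable_compose[OF this measurable_kernel[OF t A]]
    have "(\<lambda>x. emeasure (P x) {\<omega> \<in> space M. Z t \<omega> \<in> A}) \<in> borel_measurable \<nu>" .
    then show ?thesis
      by (subst measurable_cong) (auto simp: emeasure_law space_P sp t A)
  qed
qed

text \<open>
  The law after time \<open>t\<close> of the process with initial measure \<open>\<nu>\<close>, with the mass absorbed at 0 removed.
\<close>

definition transport :: "real \<Rightarrow> real measure \<Rightarrow> real measure" where
  "transport t \<nu> = restrict_space (\<nu> \<bind> law t) {0<..}"

lemma
  assumes nu: "sets \<nu> = sets (restrict_space borel {0<..})" and t: "0 \<le> t"
  shows sets_transport: "sets (transport t \<nu>) = sets (restrict_space borel {0<..})"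
    and emeasure_transport: "A \<in> sets borel \<Longrightarrow> A \<subseteq> {0<..} \<Longrightarrow>
      emeasure (transport t \<nu>) A = (\<integral>\<^sup>+x. emeasure (law t x) A \<partial>\<nu>)"
    and nn_integral_transport: "f \<in> borel_measurable borel \<Longrightarrow> f 0 = 0 \<Longrightarrow>
      (\<integral>\<^sup>+y. f y \<partial>transport t \<nu>) = (\<integral>\<^sup>+x. (\<integral>\<^sup>+y. f y \<partial>law t x) \<partial>\<nu>)"
proof -
  have sp: "space \<nu> = {0<..}" using sets_eq_imp_space_eq[OF nu] by (simp add: space_restrict_space)
  then have ne: "space \<nu> \<noteq> {}" by simp
  have sb[simp, measurable_cong]: "sets (\<nu> \<bind> law t) = sets borel"
    by (rule sets_bind_measurable[OF law_kernel[OF nu t] ne])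
  have spb[simp]: "space (\<nu> \<bind> law t) = UNIV" using sets_eq_imp_space_eq[OF sb] by simp
  show "sets (transport t \<nu>) = sets (restrict_space borel {0<..})"
    unfolding transport_def by (simp add: sets_restrict_space)
  show "emeasure (transport t \<nu>) A = (\<integral>\<^sup>+x. emeasure (law t x) A \<partial>\<nu>)"
    if "A \<in> sets borel" "A \<subseteq> {0<..}"
    unfolding transport_def using that
    by (subst emeasure_restrict_space) (auto simp: emeasure_bind[OF ne law_kernel[OF nu t]])
  show "(\<integral>\<^sup>+y. f y \<partial>transport t \<nu>) = (\<integral>\<^sup>+x. (\<integral>\<^sup>+y. f y \<partial>law t x) \<partial>\<nu>)"
    if [measurable]: "f \<in> borel_measurable borel" and f: "f 0 = 0"
  proof -
    have "(\<integral>\<^sup>+y. f y \<partial>transport t \<nu>) = (\<integral>\<^sup>+y. f y * indicator {0<..} y \<partial>(\<nu> \<bind> law t))"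
      unfolding transport_def by (rule nn_integral_restrict_space) simp
    also have "\<dots> = (\<integral>\<^sup>+x. (\<integral>\<^sup>+y. f y * indicator {0<..} y \<partial>law t x) \<partial>\<nu>)"
      by (rule nn_integral_bind[OF _ law_kernel[OF nu t]]) simp
    also have "\<dots> = (\<integral>\<^sup>+x. (\<integral>\<^sup>+y. f y \<partial>law t x) \<partial>\<nu>)"
    proof (rule nn_integral_cong)
      fix x assume "x \<in> space \<nu>"
      then have x: "0 \<le> x" by (simp add: sp)
      show "(\<integral>\<^sup>+y. f y * indicator {0<..} y \<partial>law t x) = (\<integral>\<^sup>+y. f y \<partial>law t x)"
        using law_nonneg[OF x t] f
        by (intro nn_integral_cong_AE) (auto elim!: eventually_mono split: split_indicator simp: less_le)
    qed
    finally show ?thesis .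
  qed
qed

text \<open>
  The semigroup moves the exponents along the flow.
\<close>

lemma transport_laplace_difference:
  assumes nu: "sets \<nu> = sets (restrict_space borel {0<..})" and t: "0 \<le> t" and ab: "0 < a" "a \<le> b"
  shows "(\<integral>\<^sup>+y. ennreal (exp (- a * y) - exp (- b * y)) \<partial>transport t \<nu>)
       = (\<integral>\<^sup>+x. ennreal (exp (- u t a * x) - exp (- u t b * x)) \<partial>\<nu>)"
proof -
  have sp: "space \<nu> = {0<..}" using sets_eq_imp_space_eq[OF nu] by (simp add: space_restrict_space)
  have "(\<integral>\<^sup>+y. ennreal (exp (- a * y) - exp (- b * y)) \<partial>transport t \<nu>)
      = (\<integral>\<^sup>+x. (\<integral>\<^sup>+y. ennreal (exp (- a * y) - exp (- b * y)) \<partial>law t x) \<partial>\<nu>)"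
    by (rule nn_integral_transport[OF nu t]) auto
  also have "\<dots> = (\<integral>\<^sup>+x. ennreal (exp (- u t a * x) - exp (- u t b * x)) \<partial>\<nu>)"
    by (intro nn_integral_cong) (use law_laplace_difference[OF _ t ab] in \<open>auto simp: sp mult.commute\<close>)
  finally show ?thesis .
qed

lemma stationary_measure_iff:
  assumes nu: "radon_on {0<..} \<nu>"
  shows "stationary_measure P Z \<nu> \<longleftrightarrow> (\<forall>t>0. transport t \<nu> = \<nu>)"
proof -
  have sets: "sets \<nu> = sets (restrict_space borel {0<..})" using nu by (simp add: radon_on_def)
  have sp: "space \<nu> = {0<..}" using sets_eq_imp_space_eq[OF sets] by (simp add: space_restrict_space)
  have eq: "(\<integral>\<^sup>+x. emeasure (P x) {\<omega> \<in> space (P x). Z t \<omega> \<in> A} \<partial>\<nu>) = emeasure (transport t \<nu>) A"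
    if "A \<in> sets (restrict_space borel {0<..})" "0 < t" for A t
  proof -
    have A: "A \<in> sets borel" "A \<subseteq> {0<..}" using that(1) by (auto simp: sets_restrict_space_iff)
    show ?thesis
      using that A by (simp add: emeasure_transport[OF sets], intro nn_integral_cong) (auto simp: emeasure_law sp)
  qed
  have "transport t \<nu> = \<nu> \<longleftrightarrow>
      (\<forall>A\<in>sets (restrict_space borel {0<..}). emeasure (transport t \<nu>) A = emeasure \<nu> A)" if "0 < t" for t
    using sets sets_transport[OF sets, of t] that by (auto intro!: measure_eqI)
  then show ?thesis using nu by (auto simp: stationary_measure_def eq)
qed

text \<open>
  Letting \<open>b\<close> tend to infinity in \<open>mu_laplace_difference\<close>, the integral of \<open>exp (- y)\<close> against \<open>\<mu>\<close> is at
  most what the clock has left above 1, which is finite by Grey's condition. In particular \<open>\<mu>\<close> is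
  finite near 0.
\<close>

lemma emeasure_mu_Ioc_finite: "emeasure \<mu> {0<..b} < \<infinity>"
proof -
  obtain B where B: "\<And>l. 0 < l \<Longrightarrow> clock l \<le> B" using clock_bounded_above[OF grey] by blast
  let ?e = "\<lambda>y. exp (- 1 * y)"
  have int: "(\<integral>\<^sup>+y. ennreal (?e y) \<partial>\<mu>) \<le> ennreal (B - clock 1)"
  proof -
    have sp: "space \<mu> = {0<..}" using sets_eq_imp_space_eq[OF sets_mu] by (simp add: space_restrict_space)
    have lim: "(\<lambda>n. ennreal (?e y - exp (- real (Suc n) * y))) \<longlonglongrightarrow> ennreal (?e y)" if "0 < y" for y
      using tendsto_diff[OF tendsto_const exp_neg_Suc_mult_tendsto_zero[OF that], of "?e y"]
      by (intro tendsto_ennrealI) simp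
    have meas: "(\<lambda>y. ennreal (?e y - exp (- real (Suc n) * y))) \<in> borel_measurable \<mu>" for n
      using measurable_restrict_space1[of "\<lambda>y. ennreal (?e y - exp (- real (Suc n) * y))" borel borel "{0<..}"]
      by (simp cong: measurable_cong_sets[OF sets_mu refl])
    have "(\<integral>\<^sup>+y. ennreal (?e y) \<partial>\<mu>) = (\<integral>\<^sup>+y. liminf (\<lambda>n. ennreal (?e y - exp (- real (Suc n) * y))) \<partial>\<mu>)"
      by (intro nn_integral_cong lim_imp_Liminf[symmetric] lim trivial_limit_sequentially)
        (simp_all add: sp)
    also have "\<dots> \<le> liminf (\<lambda>n. \<integral>\<^sup>+y. ennreal (?e y - exp (- real (Suc n) * y)) \<partial>\<mu>)"
      by (rule nn_integral_liminf[OF meas])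
    also have "\<dots> \<le> ennreal (B - clock 1)"
    proof (rule Liminf_le)
      show "\<forall>\<^sub>F n in sequentially. (\<integral>\<^sup>+y. ennreal (?e y - exp (- real (Suc n) * y)) \<partial>\<mu>) \<le> ennreal (B - clock 1)"
        by (intro always_eventually allI, subst mu_laplace_difference) (auto intro!: ennreal_leI B)
    qed simp
    finally show ?thesis .
  qed
  have "emeasure \<mu> {0<..b} = (\<integral>\<^sup>+y. indicator {0<..b} y \<partial>\<mu>)"
    by (rule nn_integral_indicator[symmetric]) (auto simp: sets_mu sets_restrict_space_iff)
  also have "\<dots> \<le> (\<integral>\<^sup>+y. ennreal (exp b) * ennreal (?e y) \<partial>\<mu>)"
    by (intro nn_integral_mono) (auto split: split_indicator simp: ennreal_mult'[symmetric] exp_add[symmetric]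
        simp flip: ennreal_1 intro!: ennreal_leI)
  also have "\<dots> = ennreal (exp b) * (\<integral>\<^sup>+y. ennreal (?e y) \<partial>\<mu>)"
    using measurable_restrict_space1[of "\<lambda>y. ennreal (?e y)" borel borel "{0<..}"]
    by (intro nn_integral_cmult) (simp cong: measurable_cong_sets[OF sets_mu refl])
  also have "\<dots> \<le> ennreal (exp b) * ennreal (B - clock 1)" by (intro mult_left_mono int) simp
  also have "\<dots> < \<infinity>" by (simp add: ennreal_mult_less_top)
  finally show ?thesis .
qed

lemma mu_radon: "radon_on {0<..} \<mu>"
  unfolding radon_on_def
proof (intro conjI allI impI sets_mu, elim conjE)
  fix K :: "real set" assume K: "compact K" "K \<subseteq> {0<..}"
  obtain b where b: "\<And>y. y \<in> K \<Longrightarrow> \<bar>y\<bar> \<le> b"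
    using compact_imp_bounded[OF K(1)] unfolding bounded_iff real_norm_def by blast
  have "emeasure \<mu> K \<le> emeasure \<mu> {0<..b}"
    using K(2) b by (intro emeasure_mono) (fastforce, auto simp: sets_mu sets_restrict_space_iff)
  then show "emeasure \<mu> K < \<infinity>" using emeasure_mu_Ioc_finite le_less_trans by blast
qed

text \<open>
  The flow preserves clock distances.
\<close>

lemma mu_stationary: "stationary_measure P Z \<mu>"
  unfolding stationary_measure_iff[OF mu_radon]
proof (intro allI impI)
  fix t :: real assume t: "0 < t"
  have eq: "(\<integral>\<^sup>+y. ennreal (exp (- a * y) - exp (- b * y)) \<partial>transport t \<mu>) = ennreal (clock b - clock a)"
    if ab: "0 < a" "a \<le> b" for a b
  proof -
    have "(\<integral>\<^sup>+y. ennreal (exp (- a * y) - exp (- b * y)) \<partial>transport t \<mu>) = ennreal (clock (u t b) - clock (u t a))"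
      using transport_laplace_difference[OF sets_mu _ ab, of t] t ab mu_laplace_difference u_pos u_mono by simp
    then show ?thesis using clock_flow t ab by simp
  qed
  show "transport t \<mu> = \<mu>"
  proof (rule measure_eqI_laplace_difference)
    show "sets (transport t \<mu>) = sets (restrict_space borel {0<..})"
      using t by (intro sets_transport sets_mu) simp
    fix a b :: real assume ab: "0 < a" "a \<le> b"
    show "(\<integral>\<^sup>+y. ennreal (exp (- a * y) - exp (- b * y)) \<partial>transport t \<mu>)
        = (\<integral>\<^sup>+y. ennreal (exp (- a * y) - exp (- b * y)) \<partial>\<mu>)"
      unfolding eq[OF ab] mu_laplace_difference[OF ab] ..
    show "(\<integral>\<^sup>+y. ennreal (exp (- a * y) - exp (- b * y)) \<partial>transport t \<mu>) < \<infinity>"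
      unfolding eq[OF ab] by simp
  qed (rule sets_mu)
qed

lemma mu_nonzero: "emeasure \<mu> (space \<mu>) \<noteq> 0"
proof
  assume "emeasure \<mu> (space \<mu>) = 0"
  then have "\<mu> = null_measure \<mu>"
    by (intro measure_eqI) (auto, metis emeasure_space le_zero_eq)
  then have "(\<integral>\<^sup>+y. ennreal (exp (- 1 * y) - exp (- 2 * y)) \<partial>\<mu>) = 0"
    by (metis nn_integral_null_measure)
  then show False using mu_laplace_difference[of 1 2] clock_less[of 1 2] by simp
qed

text \<open>
  A Radon measure on \<open>(0, \<infinity>)\<close> could grow arbitrarily fast at 0 and at infinity; stationarity excludes
  this. It identifies the integral of \<open>x \<mapsto> P x (Z t \<in> K)\<close> with \<open>\<nu> K < \<infinity>\<close>, and for \<open>v t \<le> a\<close> and the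
  interval \<open>K\<close> of \<open>law_window\<close> this integrand dominates \<open>exp (- a * x) - exp (- b * x)\<close>.
\<close>

lemma stationary_laplace_difference_finite:
  assumes st: "stationary_measure P Z \<nu>" and ab: "0 < a" "a \<le> b"
  shows "(\<integral>\<^sup>+x. ennreal (exp (- a * x) - exp (- b * x)) \<partial>\<nu>) < \<infinity>"
proof -
  have radon: "radon_on {0<..} \<nu>" using st by (simp add: stationary_measure_def)
  then have sets: "sets \<nu> = sets (restrict_space borel {0<..})" by (simp add: radon_on_def)
  have sp: "space \<nu> = {0<..}" using sets_eq_imp_space_eq[OF sets] by (simp add: space_restrict_space)
  obtain t where t: "0 < t" "v t \<le> a" using v_small[OF ab(1)] by blast
  have V: "0 < v t" by (rule v_pos[OF t(1)])
  obtain p q where p: "0 < p" and window: "\<And>x. 0 < x \<Longrightarrow>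
      ennreal (1 / 4 * min 1 (x * v t) * exp (- x * v t)) \<le> emeasure (law t x) {p..q}"
    using law_window[OF t(1)] by blast
  \<comment> \<open>from \<open>1 - exp (- (b - a) * x) \<le> min 1 ((b - a) * x)\<close>; the 4 compensates the 1/4 of the window\<close>
  define C where "C = 4 * max 1 ((b - a) / v t)"
  have C: "0 \<le> C" by (simp add: C_def)
  have bound: "exp (- a * x) - exp (- b * x) \<le> C * (1 / 4 * min 1 (x * v t) * exp (- x * v t))"
    if x: "0 < x" for x
  proof -
    have "exp (- a * x) - exp (- b * x) = exp (- a * x) * (1 - exp (- (b - a) * x))"
      by (simp add: right_diff_distrib exp_add[symmetric] algebra_simps)
    also have "\<dots> \<le> exp (- x * v t) * (max 1 ((b - a) / v t) * min 1 (x * v t))"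
    proof (rule mult_mono)
      show "exp (- a * x) \<le> exp (- x * v t)" using t x by (simp add: mult.commute)
      show "0 \<le> 1 - exp (- (b - a) * x)" using ab x by (simp add: mult_nonpos_nonneg)
      show "1 - exp (- (b - a) * x) \<le> max 1 ((b - a) / v t) * min 1 (x * v t)"
      proof (cases "1 \<le> x * v t")
        case True
        then show ?thesis by (simp add: min_absorb1 le_max_iff_disj add_increasing)
      next
        case False
        have "1 - exp (- (b - a) * x) \<le> (b - a) * x" using exp_ge_add_one_self[of "- (b - a) * x"] by (simp add: algebra_simps)
        also have "\<dots> = (b - a) / v t * (x * v t)" using V by simp
        also have "\<dots> \<le> max 1 ((b - a) / v t) * (x * v t)" using x V by (intro mult_right_mono) auto
        finally show ?thesis using False by simp
      qed
    qed simp
    finally show ?thesis by (simp add: C_def mult_ac)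
  qed
  have "compact {p..q} \<and> {p..q} \<subseteq> {0<..}" using p by auto
  then have fin: "emeasure \<nu> {p..q} < \<infinity>" using radon unfolding radon_on_def by blast
  have kernel: "law t \<in> \<nu> \<rightarrow>\<^sub>M subprob_algebra borel" using t by (intro law_kernel[OF sets]) simp
  have "(\<integral>\<^sup>+x. ennreal (exp (- a * x) - exp (- b * x)) \<partial>\<nu>) \<le> (\<integral>\<^sup>+x. ennreal C * emeasure (law t x) {p..q} \<partial>\<nu>)"
  proof (rule nn_integral_mono)
    fix x assume "x \<in> space \<nu>"
    then have x: "0 < x" by (simp add: sp)
    have "ennreal (exp (- a * x) - exp (- b * x)) \<le> ennreal C * ennreal (1 / 4 * min 1 (x * v t) * exp (- x * v t))"
      using bound[OF x] C by (simp add: ennreal_mult'[symmetric] ennreal_leI)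
    also have "\<dots> \<le> ennreal C * emeasure (law t x) {p..q}" by (intro mult_left_mono window x) simp
    finally show "ennreal (exp (- a * x) - exp (- b * x)) \<le> ennreal C * emeasure (law t x) {p..q}" .
  qed
  also have "\<dots> = ennreal C * (\<integral>\<^sup>+x. emeasure (law t x) {p..q} \<partial>\<nu>)"
    by (intro nn_integral_cmult measurable_emeasure_kernel[OF kernel]) simp
  also have "(\<integral>\<^sup>+x. emeasure (law t x) {p..q} \<partial>\<nu>) = emeasure (transport t \<nu>) {p..q}"
    using t p by (intro emeasure_transport[OF sets, symmetric]) auto
  also have "transport t \<nu> = \<nu>" using st t stationary_measure_iff[OF radon] by blast
  finally show ?thesis using fin by (simp add: ennreal_mult_less_top le_less_trans)
qed

text \<open>
  Let \<open>d a b\<close> be the integral of \<open>exp (- a * x) - exp (- b * x)\<close> against \<open>\<nu>\<close>. It is additive in adjacent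
  intervals and invariant under the flow, so \<open>d (u t l) l\<close> depends on \<open>t\<close> only, and it is additive in
  \<open>t\<close>. Hence it is linear in \<open>t\<close>; since \<open>t\<close> is the clock distance of \<open>u t l\<close> and \<open>l\<close>, the measure \<open>\<nu>\<close>
  behaves like a multiple of \<open>\<mu>\<close>.
\<close>

lemma stationary_unique:
  assumes st: "stationary_measure P Z \<nu>"
  shows "\<exists>c\<ge>0. \<nu> = scale_measure (ennreal c) \<mu>"
proof -
  have radon: "radon_on {0<..} \<nu>" using st by (simp add: stationary_measure_def)
  then have sets: "sets \<nu> = sets (restrict_space borel {0<..})" by (simp add: radon_on_def)
  have sp: "space \<nu> = {0<..}" using sets_eq_imp_space_eq[OF sets] by (simp add: space_restrict_space)
  define d where "d a b = enn2real (\<integral>\<^sup>+x. ennreal (exp (- a * x) - exp (- b * x)) \<partial>\<nu>)" for a b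
  have d: "(\<integral>\<^sup>+x. ennreal (exp (- a * x) - exp (- b * x)) \<partial>\<nu>) = ennreal (d a b)" if "0 < a" "a \<le> b" for a b
    using stationary_laplace_difference_finite[OF st that] by (simp add: d_def)
  have d_nonneg: "0 \<le> d a b" for a b by (simp add: d_def)
  have meas: "(\<lambda>x. ennreal (exp (- a * x) - exp (- b * x))) \<in> borel_measurable \<nu>" for a b
    using measurable_restrict_space1[of "\<lambda>x. ennreal (exp (- a * x) - exp (- b * x))" borel borel "{0<..}"]
    by (simp cong: measurable_cong_sets[OF sets refl])
  have d_add: "d a c = d a b + d b c" if "0 < a" "a \<le> b" "b \<le> c" for a b c
  proof -
    have "(\<integral>\<^sup>+x. ennreal (exp (- a * x) - exp (- c * x)) \<partial>\<nu>)
        = (\<integral>\<^sup>+x. ennreal (exp (- a * x) - exp (- b * x)) + ennreal (exp (- b * x) - exp (- c * x)) \<partial>\<nu>)"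
      using that by (intro nn_integral_cong) (auto simp: sp ennreal_plus[symmetric] simp del: ennreal_plus)
    also have "\<dots> = ennreal (d a b) + ennreal (d b c)"
      using d[of a b] d[of b c] that by (subst nn_integral_add[OF meas meas]) simp
    finally have "ennreal (d a c) = ennreal (d a b + d b c)"
      using d[of a c] that by (simp add: d_nonneg)
    then show ?thesis using d_nonneg by (simp del: ennreal_plus)
  qed
  have d_flow: "d (u t a) (u t b) = d a b" if "0 < a" "a \<le> b" "0 \<le> t" for a b t
  proof (cases "t = 0")
    case False
    then have "transport t \<nu> = \<nu>" using st that stationary_measure_iff[OF radon] by auto
    then show ?thesis using transport_laplace_difference[OF sets that(3,1,2)] by (simp add: d_def)
  qed (use that in \<open>simp add: u_zero\<close>)
  define m where "m t = d (u t 1) 1" for t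
  have m: "d (u t l) l = m t" if l: "0 < l" and t: "0 \<le> t" for l t
  proof -
    have indep: "d (u t l) l = d (u t l') l'" if "0 < l" "l \<le> l'" for l l'
      using d_add[of "u t l" l l'] d_add[of "u t l" "u t l'" l'] d_flow[of l l' t]
        that t u_pos u_le[of l t] u_le[of l' t] u_mono[of l l' t] by simp
    show ?thesis unfolding m_def using indep[of l 1] indep[of 1 l] l by (cases "l \<le> 1") auto
  qed
  have m_add: "m (s + t) = m s + m t" if "0 \<le> s" "0 \<le> t" for s t
    using d_add[of "u (s + t) 1" "u t 1" 1] m[of "u t 1" s] u_semigroup[of 1 s t]
      u_pos[of 1] u_le[of 1 t] u_le[of "u t 1" s] that by (simp add: m_def)
  have lin: "m t = m 1 * t" if "0 \<le> t" for t
    using additive_nonneg_imp_linear[of m t] m_add d_nonneg that by (simp add: m_def)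
  have d_eq: "d a b = m 1 * (clock b - clock a)" if ab: "0 < a" "a \<le> b" for a b
  proof -
    have "0 \<le> clock b - clock a" using clock_le_iff[of a b] ab by simp
    then show ?thesis using u_eqI[of b a "clock b - clock a"] m[of b "clock b - clock a"] lin[of "clock b - clock a"] ab by simp
  qed
  have m1: "0 \<le> m 1" by (simp add: m_def d_nonneg)
  have "\<nu> = scale_measure (ennreal (m 1)) \<mu>"
  proof (rule measure_eqI_laplace_difference[OF sets])
    show "sets (scale_measure (ennreal (m 1)) \<mu>) = sets (restrict_space borel {0<..})" by (simp add: sets_mu)
    fix a b :: real assume ab: "0 < a" "a \<le> b"
    have meas\<mu>: "(\<lambda>x. ennreal (exp (- a * x) - exp (- b * x))) \<in> borel_measurable \<mu>"
      using meas by (simp cong: measurable_cong_sets add: sets sets_mu)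
    show "(\<integral>\<^sup>+x. ennreal (exp (- a * x) - exp (- b * x)) \<partial>\<nu>)
        = (\<integral>\<^sup>+x. ennreal (exp (- a * x) - exp (- b * x)) \<partial>scale_measure (ennreal (m 1)) \<mu>)"
      unfolding d[OF ab] d_eq[OF ab] nn_integral_scale_measure[OF meas\<mu>] mu_laplace_difference[OF ab]
      by (rule ennreal_mult'[OF m1])
    show "(\<integral>\<^sup>+x. ennreal (exp (- a * x) - exp (- b * x)) \<partial>\<nu>) < \<infinity>" by (simp only: d[OF ab]) simp
  qed
  then show ?thesis using m1 by blast
qed

lemma the_stationary_mu: "the_stationary_measure P Z \<mu>"
  unfolding the_stationary_measure_def using mu_stationary mu_nonzero stationary_unique by blast

end

section \<open>Convergence of the potential measures\<close>

lemma sets_extend_by_zero[simp]: "sets (extend_by_zero \<nu>) = sets (restrict_space borel {0..})"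
  by (simp add: extend_by_zero_def)

lemma measurable_into_closed_half_line:
  assumes "sets \<nu> = sets (restrict_space borel {0<..})"
  shows "(\<lambda>y. y) \<in> \<nu> \<rightarrow>\<^sub>M restrict_space borel {0::real..}"
  unfolding measurable_cong_sets[OF assms refl]
  by (intro measurable_restrict_space2 measurable_restrict_space1) (auto simp: space_restrict_space)

lemma nn_integral_extend_by_zero:
  assumes "sets \<nu> = sets (restrict_space borel {0<..})" "f \<in> borel_measurable (restrict_space borel {0..})"
  shows "(\<integral>\<^sup>+y. f y \<partial>extend_by_zero \<nu>) = (\<integral>\<^sup>+y. f y \<partial>\<nu>)"
  unfolding extend_by_zero_def
  by (subst nn_integral_distr[OF measurable_into_closed_half_line[OF assms(1)]]) (use assms(2) in auto)

lemma radon_extend_by_zeroI: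
  assumes sets: "sets \<nu> = sets (restrict_space borel {0<..})" and fin: "\<And>b. emeasure \<nu> {0<..b} < \<infinity>"
  shows "radon_on {0..} (extend_by_zero \<nu>)"
  unfolding radon_on_def
proof (intro conjI allI impI sets_extend_by_zero, elim conjE)
  fix K :: "real set" assume K: "compact K" "K \<subseteq> {0..}"
  have sp: "space \<nu> = {0<..}" using sets_eq_imp_space_eq[OF sets] by (simp add: space_restrict_space)
  obtain b where b: "\<And>y. y \<in> K \<Longrightarrow> \<bar>y\<bar> \<le> b"
    using compact_imp_bounded[OF K(1)] unfolding bounded_iff real_norm_def by blast
  have "K \<in> sets borel" using K(1) by (simp add: borel_compact)
  then have "emeasure (extend_by_zero \<nu>) K = emeasure \<nu> (K \<inter> {0<..})"
    unfolding extend_by_zero_def using K(2)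
    by (subst emeasure_distr[OF measurable_into_closed_half_line[OF sets]])
      (auto simp: sets_restrict_space_iff sp vimage_def)
  also have "\<dots> \<le> emeasure \<nu> {0<..b}"
    using b by (intro emeasure_mono) (fastforce, auto simp: sets sets_restrict_space_iff)
  finally show "emeasure (extend_by_zero \<nu>) K < \<infinity>" using fin le_less_trans by blast
qed

context cb_scale begin

abbreviation g :: "real \<Rightarrow> real \<Rightarrow> real" where "g x y \<equiv> (W y - W (y - x)) / y"

lemma sets_potential: "0 \<le> x \<Longrightarrow> sets (potential_measure P Z x) = sets (restrict_space borel {0<..})"
  by (simp add: potential_measure_eq_occupation sets_occupation)

lemma nn_integral_potential_density:
  assumes "0 \<le> x" "f \<in> borel_measurable (restrict_space borel {0<..})"
  shows "(\<integral>\<^sup>+y. f y \<partial>potential_measure P Z x)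
       = (\<integral>\<^sup>+y. ennreal (g x y) * f y \<partial>restrict_space lborel {0<..})"
  unfolding potential_density[OF assms(1)] using assms(2)
  by (intro nn_integral_density) (auto intro!: measurable_restrict_space1 cong: measurable_cong_sets simp: sets_restrict_space)

lemma nn_integral_mu_density:
  assumes "f \<in> borel_measurable (restrict_space borel {0<..})"
  shows "(\<integral>\<^sup>+y. f y \<partial>\<mu>) = (\<integral>\<^sup>+y. ennreal (W y / y) * f y \<partial>restrict_space lborel {0<..})"
  unfolding \<mu>_def using assms
  by (intro nn_integral_density) (auto intro!: measurable_restrict_space1 cong: measurable_cong_sets simp: sets_restrict_space)

lemma potential_integral_mono:
  assumes x: "0 \<le> x" "x \<le> x'" and f: "f \<in> borel_measurable (restrict_space borel {0<..})"
  shows "(\<integral>\<^sup>+y. f y \<partial>potential_measure P Z x) \<le> (\<integral>\<^sup>+y. f y \<partial>potential_measure P Z x')"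
proof -
  have "W (y - x') \<le> W (y - x)" for y using x by (intro W_mono) simp
  then show ?thesis
    using x by (simp add: nn_integral_potential_density f space_restrict_space)
      (intro nn_integral_mono mult_right_mono ennreal_leI divide_right_mono, auto simp: space_restrict_space)
qed

lemma potential_integral_le_mu:
  assumes x: "0 \<le> x" and f: "f \<in> borel_measurable (restrict_space borel {0<..})"
  shows "(\<integral>\<^sup>+y. f y \<partial>potential_measure P Z x) \<le> (\<integral>\<^sup>+y. f y \<partial>\<mu>)"
  unfolding nn_integral_potential_density[OF x f] nn_integral_mu_density[OF f]
  by (intro nn_integral_mono mult_right_mono ennreal_leI divide_right_mono) (auto simp: space_restrict_space W_nonneg)

text \<open>
  The integrals increase with \<open>x\<close> and are bounded by the limit. At each \<open>y\<close> the potential density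
  equals \<open>W y / y\<close> as soon as \<open>x > y\<close>, so Fatou's lemma along the integers gives the converse bound.
\<close>

lemma potential_integral_tendsto:
  assumes f: "f \<in> borel_measurable (restrict_space borel {0<..})"
  shows "((\<lambda>x. \<integral>\<^sup>+y. f y \<partial>potential_measure P Z x) \<longlongrightarrow> (\<integral>\<^sup>+y. f y \<partial>\<mu>)) at_top"
proof (rule increasing_tendsto)
  show "\<forall>\<^sub>F x in at_top. (\<integral>\<^sup>+y. f y \<partial>potential_measure P Z x) \<le> (\<integral>\<^sup>+y. f y \<partial>\<mu>)"
    using eventually_ge_at_top[of 0] by eventually_elim (rule potential_integral_le_mu[OF _ f])
  fix z assume z: "z < (\<integral>\<^sup>+y. f y \<partial>\<mu>)"
  let ?R = "restrict_space lborel {0::real<..}"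
  have "(\<integral>\<^sup>+y. f y \<partial>\<mu>) = (\<integral>\<^sup>+y. liminf (\<lambda>n. ennreal (g (real n) y) * f y) \<partial>?R)"
    unfolding nn_integral_mu_density[OF f]
  proof (rule nn_integral_cong)
    fix y :: real
    obtain N where N: "y < real N" using reals_Archimedean2 by blast
    have "(\<lambda>n. ennreal (g (real n) y) * f y) \<longlonglongrightarrow> ennreal (W y / y) * f y"
      using N by (intro tendsto_eventually eventually_sequentiallyI[of N]) (simp add: W_neg)
    then show "ennreal (W y / y) * f y = liminf (\<lambda>n. ennreal (g (real n) y) * f y)"
      by (intro lim_imp_Liminf[symmetric]) simp_all
  qed
  also have "\<dots> \<le> liminf (\<lambda>n. \<integral>\<^sup>+y. ennreal (g (real n) y) * f y \<partial>?R)"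
  proof (rule nn_integral_liminf)
    fix n
    have "f \<in> borel_measurable ?R" using f by (simp cong: measurable_cong_sets add: sets_restrict_space)
    then show "(\<lambda>y. ennreal (g (real n) y) * f y) \<in> borel_measurable ?R"
      by (rule borel_measurable_times_ennreal[rotated]) (auto intro!: measurable_restrict_space1)
  qed
  also have "\<dots> = liminf (\<lambda>n. \<integral>\<^sup>+y. f y \<partial>potential_measure P Z (real n))"
    by (simp add: nn_integral_potential_density f)
  finally have "z < liminf (\<lambda>n. \<integral>\<^sup>+y. f y \<partial>potential_measure P Z (real n))" using z by simp
  then obtain n where n: "z < (\<integral>\<^sup>+y. f y \<partial>potential_measure P Z (real n))"
    using eventually_happens[OF less_LiminfD] by fastforce
  show "\<forall>\<^sub>F x in at_top. z < (\<integral>\<^sup>+y. f y \<partial>potential_measure P Z x)"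
    using eventually_ge_at_top[of "real n"]
    by eventually_elim (rule less_le_trans[OF n potential_integral_mono[OF _ _ f]], auto)
qed

lemma potential_vaguely_converges: "vaguely_converges (potential_measure P Z) \<mu> at_top"
  unfolding vaguely_converges_def
proof (intro conjI allI impI; (elim conjE)?)
  show "radon_on {0..} (extend_by_zero \<mu>)"
    by (rule radon_extend_by_zeroI[OF sets_mu emeasure_mu_Ioc_finite])
  show "\<forall>\<^sub>F x in at_top. radon_on {0..} (extend_by_zero (potential_measure P Z x))"
    using eventually_ge_at_top[of 0]
  proof eventually_elim
    case (elim x)
    show ?case
    proof (rule radon_extend_by_zeroI[OF sets_potential[OF elim]])
      fix b :: real
      have A: "{0<..b} \<in> sets (restrict_space borel {0<..})" by (auto simp: sets_restrict_space_iff)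
      have "emeasure (potential_measure P Z x) {0<..b} \<le> emeasure \<mu> {0<..b}"
        using potential_integral_le_mu[OF elim, of "indicator {0<..b}"] A sets_potential[OF elim] sets_mu
        by simp
      then show "emeasure (potential_measure P Z x) {0<..b} < \<infinity>"
        using emeasure_mu_Ioc_finite le_less_trans by blast
    qed
  qed
  fix h :: "real \<Rightarrow> real"
  assume h: "continuous_on {0..} h" and ex: "integral_exists (extend_by_zero \<mu>) h"
  have hm: "h \<in> borel_measurable (restrict_space borel {0..})"
    using borel_measurable_continuous_on_restrict[OF h] .
  have hm': "h \<in> borel_measurable (restrict_space borel {0<..})"
    by (rule borel_measurable_continuous_on_restrict, rule continuous_on_subset[OF h]) auto
  have pm: "(\<lambda>y. ennreal (h y)) \<in> borel_measurable (restrict_space borel {0..})"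
    "(\<lambda>y. ennreal (- h y)) \<in> borel_measurable (restrict_space borel {0..})"
    "(\<lambda>y. ennreal (h y)) \<in> borel_measurable (restrict_space borel {0<..})"
    "(\<lambda>y. ennreal (- h y)) \<in> borel_measurable (restrict_space borel {0<..})"
    using hm hm' by measurable
  note mu_int = nn_integral_extend_by_zero[OF sets_mu pm(1)] nn_integral_extend_by_zero[OF sets_mu pm(2)]
  note pot_int = nn_integral_extend_by_zero[OF sets_potential pm(1)] nn_integral_extend_by_zero[OF sets_potential pm(2)]
  have fin: "(\<integral>\<^sup>+y. ennreal (h y) \<partial>\<mu>) < \<infinity> \<or> (\<integral>\<^sup>+y. ennreal (- h y) \<partial>\<mu>) < \<infinity>"
    using ex by (simp add: integral_exists_def mu_int)
  show "\<forall>\<^sub>F x in at_top. integral_exists (extend_by_zero (potential_measure P Z x)) h"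
    using eventually_ge_at_top[of 0]
  proof eventually_elim
    case (elim x)
    have "h \<in> borel_measurable (extend_by_zero (potential_measure P Z x))"
      using hm by (simp cong: measurable_cong_sets)
    moreover have "(\<integral>\<^sup>+y. ennreal (h y) \<partial>potential_measure P Z x) < \<infinity>
        \<or> (\<integral>\<^sup>+y. ennreal (- h y) \<partial>potential_measure P Z x) < \<infinity>"
      using fin potential_integral_le_mu[OF elim pm(3)] potential_integral_le_mu[OF elim pm(4)] le_less_trans by blast
    ultimately show ?case by (simp add: integral_exists_def pot_int elim)
  qed
  have "((\<lambda>x. enn2ereal (\<integral>\<^sup>+y. ennreal (h y) \<partial>potential_measure P Z x)
          - enn2ereal (\<integral>\<^sup>+y. ennreal (- h y) \<partial>potential_measure P Z x))
      \<longlongrightarrow> enn2ereal (\<integral>\<^sup>+y. ennreal (h y) \<partial>\<mu>) - enn2ereal (\<integral>\<^sup>+y. ennreal (- h y) \<partial>\<mu>)) at_top"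
    using fin by (intro tendsto_diff_ereal_general tendsto_enn2erealI potential_integral_tendsto pm)
      (auto simp: less_top[symmetric] dest: enn2ereal_eq_top_iff[THEN iffD1])
  then show "((\<lambda>x. extended_integral (extend_by_zero (potential_measure P Z x)) h)
      \<longlongrightarrow> extended_integral (extend_by_zero \<mu>) h) at_top"
    unfolding extended_integral_def mu_int
    by (rule Lim_transform_eventually)
      (use eventually_ge_at_top[of 0] in eventually_elim, simp add: pot_int)
qed

end

theorem theorem3p5:
  fixes \<alpha> \<sigma> :: real and \<pi> :: "real measure" and W :: "real \<Rightarrow> real"
    and M :: "'w measure" and P :: "real \<Rightarrow> 'w measure" and Z :: "real \<Rightarrow> 'w \<Rightarrow> real"
  assumes "0 \<le> \<alpha>" and "0 \<le> \<sigma>"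
    and "radon_on {0<..} \<pi>"
    and "(\<integral>\<^sup>+r. ennreal (min r (r\<^sup>2)) \<partial>\<pi>) < \<infinity>"
    and "filterlim (branching_mechanism \<alpha> \<sigma> \<pi>) at_top at_top"
    and "\<exists>c>0. set_integrable lborel {c..} (\<lambda>l. 1 / branching_mechanism \<alpha> \<sigma> \<pi> l)"
    and "cb_process (branching_mechanism \<alpha> \<sigma> \<pi>) M P Z"
    and "scale_function (branching_mechanism \<alpha> \<sigma> \<pi>) W"
  shows "(\<forall>x>0. potential_measure P Z x =
            density (restrict_space lborel {0<..}) (\<lambda>y. ennreal ((W y - W (y - x)) / y)))
       \<and> the_stationary_measure P Z (density (restrict_space lborel {0<..}) (\<lambda>y. ennreal (W y / y)))
       \<and> vaguely_converges (potential_measure P Z)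
            (density (restrict_space lborel {0<..}) (\<lambda>y. ennreal (W y / y))) at_top"
proof -
  let ?\<psi> = "branching_mechanism \<alpha> \<sigma> \<pi>"
  obtain u where u: "cumulant_flow ?\<psi> u"
    "\<And>x l t. 0 \<le> x \<Longrightarrow> 0 < l \<Longrightarrow> 0 \<le> t \<Longrightarrow> (\<integral>\<omega>. exp (- l * Z t \<omega>) \<partial>P x) = exp (- x * u t l)"
    using cb_process.laplace[OF assms(7)] by blast
  interpret cb_scale ?\<psi> W u M P Z
  proof (intro cb_scale.intro scale_flow.intro scale_pair.intro scale_flow_axioms.intro cb_scale_axioms.intro)
    show "?\<psi> 0 = 0" by (simp add: branching_mechanism_def)
  qed (fact assms u)+
  show ?thesis
    using potential_density the_stationary_mu potential_vaguely_converges unfolding \<mu>_def by simp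
qed

end
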